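(* Let $(G,\mu)$ be a countable measured groupoid which is treeable. Then $(G,\mu)$ has the Haagerup property.
   Context: **Groupoids.** A Borel groupoid is a groupoid $G$ with a standard Borel structure such that range $r$, source $s$, inverse and product are Borel; $X=G^{(0)}$ is its unit space, $G^x=r^{-1}(x)$, $G_x=s^{-1}(x)$. It is countable if all $G^x$ are countable. Given a probability measure $\mu$ on $X$, the $\sigma$-finite measure $\nu$ on $G$ is $\int_G F\,d\nu=\int_X\sum_{s(\gamma)=x}F(\gamma)\,d\mu(x)$; $\mu$ is quasi-invariant if $\nu$ is equivalent to its image under $\gamma\mapsto\gamma^{-1}$. A countable measured groupoid $(G,\mu)$ is a countable Borel groupoid with a quasi-invariant probability measure $\mu$ on $X$. An inessential reduction of $(G,\mu)$ is $G_{|U}=\{\gamma: r(\gamma)\in U,s(\gamma)\in U\}$ with $U\subset X$ Borel and conull. **Treeability.** A graphing of a countable Borel groupoid $G$ is a Borel subset $Q\subset G$ with $Q=Q^{-1}$, $Q\cap X=\emptyset$ and $\bigcup_{n\ge0}Q^n=G$, where $Q^0=X$ and $Q^n$ is the set of products of $n$ composable elements of $Q$. It makes each fibre $G^x$ a (connected, simple) graph, with vertex set $G^x$ and $\gamma_1,\gamma_2\in G^x$ adjacent iff $\gamma_1^{-1}\gamma_2\in Q$. $Q$ is a treeing if for every $x\in X$ this graph is a tree. $G$ is treeable if it has a treeing, and $(G,\mu)$ is treeable if some inessential reduction $G_{|U}$ is a treeable Borel groupoid. **Haagerup property.** A Borel function $F:G\to\mathbb{C}$ is positive definite if there is a $\mu$-null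 set $N\subset X$ such that for all $x\notin N$ and $\gamma_1,\dots,\gamma_k\in G^x$ the matrix $[F(\gamma_i^{-1}\gamma_j)]$ is positive (semi-definite). $(G,\mu)$ has the Haagerup property (property (H)) if there is a sequence $(F_n)$ of positive definite functions on $G$ with (i) $(F_n)_{|X}=1$ a.e.; (ii) $\nu(\{|F_n|>\varepsilon\})<+\infty$ for every $\varepsilon>0$; (iii) $\lim_nF_n=1$ a.e. *)

theory Defs
  imports "HOL-Analysis.Analysis" "HOL-Probability.Probability_Measure"
begin

text \<open>A measurable space is represented by a value of type \<open>'a measure\<close> of which only
  \<open>space\<close> and \<open>sets\<close> are used.\<close>

definition standard_borel :: "'a measure \<Rightarrow> bool" where
  "standard_borel M \<longleftrightarrow>
     (\<exists>T. completely_metrizable_space T \<and> second_countable T \<and>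
          topspace T = space M \<and> sets M = sigma_sets (space M) {U. openin T U})"

text \<open>The unit space is a subset of the groupoid. The operations are total functions in HOL;
  their values outside the groupoid, and the value of \<open>gmult\<close> on pairs that are not composable,
  are irrelevant.\<close>

record 'g groupoid =
  bspace :: "'g measure"
  units :: "'g set"
  rng :: "'g \<Rightarrow> 'g"
  src :: "'g \<Rightarrow> 'g"
  ginv :: "'g \<Rightarrow> 'g"
  gmult :: "'g \<Rightarrow> 'g \<Rightarrow> 'g"

definition carr :: "'g groupoid \<Rightarrow> 'g set" where
  "carr G = space (bspace G)"

definition composable :: "'g groupoid \<Rightarrow> ('g \<times> 'g) set" where
  "composable G = {(a, b) \<in> carr G \<times> carr G. src G a = rng G b}"

definition rfibre :: "'g groupoid \<Rightarrow> 'g \<Rightarrow> 'g set" where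
  "rfibre G x = {a \<in> carr G. rng G a = x}"

definition sfibre :: "'g groupoid \<Rightarrow> 'g \<Rightarrow> 'g set" where
  "sfibre G x = {a \<in> carr G. src G a = x}"

definition unit_borel :: "'g groupoid \<Rightarrow> 'g measure" where
  "unit_borel G = restrict_space (bspace G) (units G)"

locale groupoid =
  fixes G :: "'g groupoid"
  assumes units_subset: "units G \<subseteq> carr G"
    and rng_in: "a \<in> carr G \<Longrightarrow> rng G a \<in> units G"
    and src_in: "a \<in> carr G \<Longrightarrow> src G a \<in> units G"
    and rng_unit: "x \<in> units G \<Longrightarrow> rng G x = x"
    and src_unit: "x \<in> units G \<Longrightarrow> src G x = x"
    and mult_in: "(a, b) \<in> composable G \<Longrightarrow> gmult G a b \<in> carr G"
    and rng_mult: "(a, b) \<in> composable G \<Longrightarrow> rng G (gmult G a b) = rng G a"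
    and src_mult: "(a, b) \<in> composable G \<Longrightarrow> src G (gmult G a b) = src G b"
    and mult_assoc: "(a, b) \<in> composable G \<Longrightarrow> (b, c) \<in> composable G \<Longrightarrow>
      gmult G (gmult G a b) c = gmult G a (gmult G b c)"
    and rng_mult_left: "a \<in> carr G \<Longrightarrow> gmult G (rng G a) a = a"
    and mult_src_right: "a \<in> carr G \<Longrightarrow> gmult G a (src G a) = a"
    and inv_in: "a \<in> carr G \<Longrightarrow> ginv G a \<in> carr G"
    and rng_inv: "a \<in> carr G \<Longrightarrow> rng G (ginv G a) = src G a"
    and src_inv: "a \<in> carr G \<Longrightarrow> src G (ginv G a) = rng G a"
    and mult_inv: "a \<in> carr G \<Longrightarrow> gmult G a (ginv G a) = rng G a"
    and inv_mult: "a \<in> carr G \<Longrightarrow> gmult G (ginv G a) a = src G a"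

text \<open>As \<open>units G\<close> carries the trace of the Borel structure of \<open>G\<close>, Borel maps into the
  unit space are the same as Borel maps into \<open>G\<close> with values in \<open>units G\<close>.\<close>

locale borel_groupoid = groupoid +
  assumes standard: "standard_borel (bspace G)"
    and rng_borel: "rng G \<in> measurable (bspace G) (bspace G)"
    and src_borel: "src G \<in> measurable (bspace G) (bspace G)"
    and inv_borel: "ginv G \<in> measurable (bspace G) (bspace G)"
    and mult_borel: "(\<lambda>(a, b). gmult G a b) \<in>
      measurable (restrict_space (bspace G \<Otimes>\<^sub>M bspace G) (composable G)) (bspace G)"

locale countable_borel_groupoid = borel_groupoid +
  assumes countable_fibres: "x \<in> units G \<Longrightarrow> countable (rfibre G x)"

text \<open>\<open>counting_measure G \<mu>\<close> is the measure \<open>\<nu>\<close> that integrates the counting measures on the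
  source fibres against \<open>\<mu>\<close>. On a countable Borel groupoid \<open>x \<mapsto> #(A \<inter> sfibre G x)\<close> is Borel
  for every Borel set \<open>A\<close> (Lusin-Novikov), so the set function below is countably additive.\<close>

definition counting_measure :: "'g groupoid \<Rightarrow> 'g measure \<Rightarrow> 'g measure" where
  "counting_measure G \<mu> = measure_of (carr G) (sets (bspace G))
     (\<lambda>A. \<integral>\<^sup>+ x. (\<integral>\<^sup>+ a. indicator A a \<partial>count_space (sfibre G x)) \<partial>\<mu>)"

definition quasi_invariant :: "'g groupoid \<Rightarrow> 'g measure \<Rightarrow> bool" where
  "quasi_invariant G \<mu> \<longleftrightarrow>
     (let \<nu> = counting_measure G \<mu>; \<nu>' = distr \<nu> (bspace G) (ginv G)
      in absolutely_continuous \<nu> \<nu>' \<and> absolutely_continuous \<nu>' \<nu>)"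

locale countable_measured_groupoid = countable_borel_groupoid G + prob_space \<mu>
  for G :: "'g groupoid" and \<mu> :: "'g measure" +
  assumes sets_mu: "sets \<mu> = sets (unit_borel G)"
    and quasi_inv: "quasi_invariant G \<mu>"

definition reduction :: "'g groupoid \<Rightarrow> 'g set \<Rightarrow> 'g groupoid" where
  "reduction G U = G\<lparr>
     bspace := restrict_space (bspace G) {a \<in> carr G. rng G a \<in> U \<and> src G a \<in> U},
     units := U\<rparr>"

definition edge_rel :: "'v set \<Rightarrow> ('v \<Rightarrow> 'v \<Rightarrow> bool) \<Rightarrow> ('v \<times> 'v) set" where
  "edge_rel V adj = {(u, v) \<in> V \<times> V. adj u v}"

definition graph_connected :: "'v set \<Rightarrow> ('v \<Rightarrow> 'v \<Rightarrow> bool) \<Rightarrow> bool" where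
  "graph_connected V adj \<longleftrightarrow> (\<forall>u\<in>V. \<forall>v\<in>V. (u, v) \<in> (edge_rel V adj)\<^sup>*)"

text \<open>A cycle is the list of its (distinct) vertices; its last vertex is joined to the first.\<close>

definition graph_cycle :: "'v set \<Rightarrow> ('v \<Rightarrow> 'v \<Rightarrow> bool) \<Rightarrow> 'v list \<Rightarrow> bool" where
  "graph_cycle V adj vs \<longleftrightarrow> length vs \<ge> 3 \<and> distinct vs \<and> set vs \<subseteq> V \<and>
     (\<forall>i. Suc i < length vs \<longrightarrow> adj (vs ! i) (vs ! Suc i)) \<and> adj (last vs) (hd vs)"

definition is_tree :: "'v set \<Rightarrow> ('v \<Rightarrow> 'v \<Rightarrow> bool) \<Rightarrow> bool" where
  "is_tree V adj \<longleftrightarrow> graph_connected V adj \<and> (\<nexists>vs. graph_cycle V adj vs)"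

definition set_mult :: "'g groupoid \<Rightarrow> 'g set \<Rightarrow> 'g set \<Rightarrow> 'g set" where
  "set_mult G A B = {gmult G a b | a b. a \<in> A \<and> b \<in> B \<and> (a, b) \<in> composable G}"

primrec set_power :: "'g groupoid \<Rightarrow> 'g set \<Rightarrow> nat \<Rightarrow> 'g set" where
  "set_power G Q 0 = units G"
| "set_power G Q (Suc n) = set_mult G (set_power G Q n) Q"

definition graphing :: "'g groupoid \<Rightarrow> 'g set \<Rightarrow> bool" where
  "graphing G Q \<longleftrightarrow> Q \<in> sets (bspace G) \<and> ginv G ` Q = Q \<and> Q \<inter> units G = {} \<and>
     (\<Union>n. set_power G Q n) = carr G"

definition treeing :: "'g groupoid \<Rightarrow> 'g set \<Rightarrow> bool" where
  "treeing G Q \<longleftrightarrow> graphing G Q \<and>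
     (\<forall>x\<in>units G. is_tree (rfibre G x) (\<lambda>a b. gmult G (ginv G a) b \<in> Q))"

definition treeable_borel :: "'g groupoid \<Rightarrow> bool" where
  "treeable_borel G \<longleftrightarrow> (\<exists>Q. treeing G Q)"

definition treeable :: "'g groupoid \<Rightarrow> 'g measure \<Rightarrow> bool" where
  "treeable G \<mu> \<longleftrightarrow>
     (\<exists>U \<in> sets (unit_borel G). units G - U \<in> null_sets \<mu> \<and> treeable_borel (reduction G U))"

definition psd_matrix :: "nat \<Rightarrow> (nat \<Rightarrow> nat \<Rightarrow> complex) \<Rightarrow> bool" where
  "psd_matrix k A \<longleftrightarrow>
     (\<forall>c :: nat \<Rightarrow> complex. (\<Sum>i<k. \<Sum>j<k. cnj (c i) * A i j * c j) \<in> \<real>\<^sub>\<ge>\<^sub>0)"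

definition positive_definite :: "'g groupoid \<Rightarrow> 'g measure \<Rightarrow> ('g \<Rightarrow> complex) \<Rightarrow> bool" where
  "positive_definite G \<mu> F \<longleftrightarrow> F \<in> borel_measurable (bspace G) \<and>
     (\<exists>N \<in> null_sets \<mu>. \<forall>x \<in> units G - N. \<forall>k. \<forall>g :: nat \<Rightarrow> 'g.
        (\<forall>i<k. g i \<in> rfibre G x) \<longrightarrow> psd_matrix k (\<lambda>i j. F (gmult G (ginv G (g i)) (g j))))"

definition haagerup_property :: "'g groupoid \<Rightarrow> 'g measure \<Rightarrow> bool" where
  "haagerup_property G \<mu> \<longleftrightarrow>
     (\<exists>F :: nat \<Rightarrow> 'g \<Rightarrow> complex.
        (\<forall>n. positive_definite G \<mu> (F n)) \<and>
        (\<forall>n. AE x in \<mu>. F n x = 1) \<and>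
        (\<forall>n. \<forall>\<epsilon>>0. emeasure (counting_measure G \<mu>) {a \<in> carr G. norm (F n a) > \<epsilon>} < \<infinity>) \<and>
        (AE a in counting_measure G \<mu>. (\<lambda>n. F n a) \<longlonglongrightarrow> 1))"

end

theory Submission
  imports Defs
begin

text \<open>For a treeing \<open>Q\<close>, the kernel \<open>t ^ d(a, b)\<close> on the fibres is positive definite for
  \<open>0 \<le> t \<le> 1\<close>, but its level sets can have infinite measure if \<open>Q\<close> has unbounded degree. Hence \<open>Q\<close>
  is exhausted, up to a null set, by symmetric Borel sets \<open>R n\<close> with at most \<open>n\<close> elements in each
  source fibre. They define forests; \<open>F n\<close> is \<open>t ^ d\<close> for the forest of \<open>R n\<close>, with
  \<open>t = 1 - 1 / (n + 2)\<close>, extended by \<open>0\<close> outside the subgroupoid generated by \<open>R n\<close>.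

  The sets \<open>R n\<close>, and the measurability of \<open>F n\<close>, are obtained from a Lusin-Novikov theorem modulo
  null sets: off a null set of sources, \<open>G\<close> is covered by countably many Borel sections of the source
  map with Borel inverse. The proof is a measure-theoretic version of the perfect set argument.\<close>

section \<open>Complete systems of Borel covers\<close>

text \<open>The functions \<open>F n\<close> have to be Borel on all of \<open>G\<close>, whereas a
  product of two Borel sets is an image and so a priori only analytic. This is why the
  \<open>R n\<close> are built from sections: a second factor taken from a section is determined by
  the source of the product, and the product set becomes a preimage. No edge may have an end in the
  discarded null set \<open>N\<close> of units, so that paths of the tree can be cut in the middle.
  An element is lost for all \<open>R n\<close> only if some element with the same source has its
  range in a null set of units, and quasi-invariance makes the set of such elements negligible. For
  the level sets, \<open>t ^ k > \<epsilon>\<close> bounds \<open>k\<close>, and there are at most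
  \<open>n ^ k\<close> products of \<open>k\<close> elements of \<open>R n\<close> in a source
  fibre; this is where bounded degree gives finite measure. Passing from the tree to the forest
  costs no positivity: the argument uses only that there are no cycles, and the kernel vanishes
  between components.\<close>

definition fip_on :: "'a set \<Rightarrow> 'a set set \<Rightarrow> bool" where
  "fip_on X F \<longleftrightarrow> (\<forall>A. finite A \<and> A \<subseteq> F \<longrightarrow> X \<inter> \<Inter>A \<noteq> {})"

lemma fip_on_mono: "fip_on X F \<Longrightarrow> F' \<subseteq> F \<Longrightarrow> fip_on X F'"
  unfolding fip_on_def by blast

text \<open>Complete systems of covers replace the refinements of a Polish topology in which given Borel
  sets become clopen.\<close>

definition complete_system :: "'a measure \<Rightarrow> 'a set set set \<Rightarrow> bool" where
  "complete_system M S \<longleftrightarrow> countable S \<and>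
     (\<forall>C\<in>S. countable C \<and> C \<subseteq> sets M \<and> space M \<subseteq> \<Union>C) \<and>
     (\<forall>F \<subseteq> \<Union>S. (\<forall>C\<in>S. F \<inter> C \<noteq> {}) \<longrightarrow> fip_on (space M) F \<longrightarrow> space M \<inter> \<Inter>F \<noteq> {})"

definition separating :: "'a measure \<Rightarrow> 'a set set set \<Rightarrow> bool" where
  "separating M S \<longleftrightarrow> (\<forall>x\<in>space M. \<forall>y\<in>space M. x \<noteq> y \<longrightarrow>
     (\<exists>C\<in>S. \<forall>A\<in>C. \<forall>B\<in>C. x \<in> A \<longrightarrow> y \<in> B \<longrightarrow> A \<inter> B = {}))"

definition decides :: "'a set set \<Rightarrow> 'a set \<Rightarrow> bool" where
  "decides C B \<longleftrightarrow> (\<forall>A\<in>C. A \<subseteq> B \<or> A \<inter> B = {})"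

lemma complete_systemD:
  assumes "complete_system M S"
  shows "countable S" "C \<in> S \<Longrightarrow> countable C" "C \<in> S \<Longrightarrow> C \<subseteq> sets M" "C \<in> S \<Longrightarrow> space M \<subseteq> \<Union>C"
  using assms unfolding complete_system_def by auto

lemma complete_systemE:
  assumes "complete_system M S" "F \<subseteq> \<Union>S" "\<And>C. C \<in> S \<Longrightarrow> F \<inter> C \<noteq> {}" "fip_on (space M) F"
  obtains x where "x \<in> space M" "\<And>A. A \<in> F \<Longrightarrow> x \<in> A"
proof -
  have "space M \<inter> \<Inter>F \<noteq> {}"
    using assms unfolding complete_system_def by (elim conjE) simp
  with that show thesis by blast
qed

lemma separating_unique:
  assumes "separating M S" "\<And>C. C \<in> S \<Longrightarrow> \<exists>A\<in>C. x \<in> A \<and> y \<in> A" "x \<in> space M" "y \<in> space M"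
  shows "x = y"
proof (rule ccontr)
  assume "x \<noteq> y"
  with assms obtain C where C: "C \<in> S" "\<forall>A\<in>C. \<forall>B\<in>C. x \<in> A \<longrightarrow> y \<in> B \<longrightarrow> A \<inter> B = {}"
    unfolding separating_def by blast
  with assms(2)[of C] show False by blast
qed

text \<open>The common point of the cells is the same for all systems involved, since it is
  already determined by the cells from the common separating subsystem.\<close>

lemma complete_systems_common_point:
  assumes S0: "separating M S0"
    and I: "countable I" "I \<noteq> {}"
    and T: "\<And>i. i \<in> I \<Longrightarrow> complete_system M (T i)" "\<And>i. i \<in> I \<Longrightarrow> S0 \<subseteq> T i"
    and F: "F \<subseteq> (\<Union>i\<in>I. \<Union>(T i))" "\<And>i C. i \<in> I \<Longrightarrow> C \<in> T i \<Longrightarrow> F \<inter> C \<noteq> {}" "fip_on (space M) F"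
  obtains x where "x \<in> space M" "\<And>A. A \<in> F \<Longrightarrow> x \<in> A"
proof -
  have "\<exists>x\<in>space M. \<forall>A\<in>F \<inter> \<Union>(T i). x \<in> A" if i: "i \<in> I" for i
  proof (rule complete_systemE[OF T(1)[OF i], of "F \<inter> \<Union>(T i)"])
    show "F \<inter> \<Union>(T i) \<inter> C \<noteq> {}" if "C \<in> T i" for C
      using F(2)[OF i that] that by blast
    show "fip_on (space M) (F \<inter> \<Union>(T i))"
      by (rule fip_on_mono[OF F(3)]) auto
  qed auto
  then obtain x where x: "\<And>i. i \<in> I \<Longrightarrow> x i \<in> space M"
      "\<And>i A. i \<in> I \<Longrightarrow> A \<in> F \<Longrightarrow> A \<in> \<Union>(T i) \<Longrightarrow> x i \<in> A"
    by (metis IntI)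
  have eq: "x i = x j" if "i \<in> I" "j \<in> I" for i j
  proof (rule separating_unique[OF S0])
    fix C assume "C \<in> S0"
    with T(2) that have C: "C \<in> T i" "C \<in> T j" by auto
    have "F \<inter> C \<noteq> {}" using F(2) that(1) C(1) by blast
    then obtain A where "A \<in> F" "A \<in> C" by blast
    with C x(2) that show "\<exists>A\<in>C. x i \<in> A \<and> x j \<in> A" by blast
  qed (use x that in auto)
  from I obtain i where i: "i \<in> I" by auto
  show thesis
  proof
    show "x i \<in> space M" using x i by auto
    fix A assume A: "A \<in> F"
    then obtain j where j: "j \<in> I" "A \<in> \<Union>(T j)" using F(1) by blast
    with A x(2) have "x j \<in> A" by blast
    thus "x i \<in> A" using eq[OF i j(1)] by simp
  qed
qed

definition decidable :: "'a measure \<Rightarrow> 'a set set set \<Rightarrow> 'a set \<Rightarrow> bool" where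
  "decidable M S B \<longleftrightarrow> (\<exists>S'. complete_system M S' \<and> S \<subseteq> S' \<and> (\<exists>C\<in>S'. decides C B))"

lemma complete_system_countable_Union:
  assumes "separating M S0" "countable I" "I \<noteq> {}"
    "\<And>i. i \<in> I \<Longrightarrow> complete_system M (T i)" "\<And>i. i \<in> I \<Longrightarrow> S0 \<subseteq> T i"
  shows "complete_system M (\<Union>i\<in>I. T i)"
  unfolding complete_system_def
proof (intro conjI allI impI ballI)
  show "countable (\<Union>i\<in>I. T i)" using assms(2,4) complete_systemD(1) by auto
  fix C assume "C \<in> (\<Union>i\<in>I. T i)"
  then obtain i where i: "i \<in> I" "C \<in> T i" by auto
  show "countable C" "C \<subseteq> sets M" "space M \<subseteq> \<Union>C"
    using complete_systemD(2-4)[OF assms(4)[OF i(1)] i(2)] by auto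
next
  fix F assume F: "F \<subseteq> \<Union>(\<Union>i\<in>I. T i)" "\<forall>C\<in>(\<Union>i\<in>I. T i). F \<inter> C \<noteq> {}" "fip_on (space M) F"
  obtain x where "x \<in> space M" "\<And>A. A \<in> F \<Longrightarrow> x \<in> A"
  proof (rule complete_systems_common_point[OF assms, where F=F])
    show "F \<subseteq> (\<Union>i\<in>I. \<Union> (T i))" using F(1) by blast
  qed (use F in auto)
  thus "space M \<inter> \<Inter>F \<noteq> {}" by blast
qed

lemma decidable_Compl:
  assumes "decidable M S B"
  shows "decidable M S (space M - B)"
proof -
  obtain S' C where *: "complete_system M S'" "S \<subseteq> S'" "C \<in> S'" "decides C B"
    using assms unfolding decidable_def by blast
  have "decides C (space M - B)"
    unfolding decides_def
  proof
    fix A assume A: "A \<in> C"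
    have "A \<subseteq> space M"
      using A complete_systemD(3)[OF *(1,3)] sets.sets_into_space by blast
    with A *(4) show "A \<subseteq> space M - B \<or> A \<inter> (space M - B) = {}"
      unfolding decides_def by blast
  qed
  with * show ?thesis unfolding decidable_def by blast
qed

text \<open>One cover has to decide the whole union, which need not be true of any
  \<open>D i\<close>; hence the partition \<open>E\<close> is added. Completeness survives: a cell
  of \<open>E\<close> meets each chosen \<open>d i\<close>, this fixes the side of
  \<open>B i\<close> on which \<open>d i\<close> lies for all \<open>i\<close> that matter, and the
  common point of the \<open>d i\<close> lies on the same sides, hence in the cell.\<close>

lemma decidable_UN:
  fixes B :: "nat \<Rightarrow> 'a set"
  assumes S: "separating M S" and B: "\<And>i. B i \<in> sets M" "\<And>i. decidable M S (B i)"
  shows "decidable M S (\<Union>i. B i)"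
proof -
  obtain T D where T: "\<And>i. complete_system M (T i)" "\<And>i. S \<subseteq> T i" "\<And>i. D i \<in> T i"
      "\<And>i. decides (D i) (B i)"
    using B(2) unfolding decidable_def by metis
  define E where "E = insert (space M - (\<Union>i. B i)) (range (disjointed B))"
  define S' where "S' = insert E (\<Union>i. T i)"
  have E_sets: "E \<subseteq> sets M"
    using B(1) sets.range_disjointed_sets[of B M] unfolding E_def by auto
  have "complete_system M S'"
    unfolding complete_system_def
  proof (intro conjI allI impI ballI)
    have "complete_system M (\<Union>i\<in>UNIV. T i)"
      by (rule complete_system_countable_Union[OF S]) (use T in auto)
    from complete_systemD[OF this] have U: "countable (\<Union>i. T i)"
       "\<And>C. C \<in> (\<Union>i. T i) \<Longrightarrow> countable C \<and> C \<subseteq> sets M \<and> space M \<subseteq> \<Union>C" by auto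
    show "countable S'" using U(1) unfolding S'_def by auto
    fix C assume C: "C \<in> S'"
    have "countable E" unfolding E_def by auto
    moreover have "space M \<subseteq> \<Union>E" unfolding E_def using UN_disjointed_eq[of B] by auto
    ultimately show "countable C" "C \<subseteq> sets M" "space M \<subseteq> \<Union>C"
      using C U(2)[of C] E_sets unfolding S'_def by auto
  next
    fix F assume F: "F \<subseteq> \<Union>S'" "\<forall>C\<in>S'. F \<inter> C \<noteq> {}" "fip_on (space M) F"
    define F' where "F' = F \<inter> (\<Union>i. \<Union>(T i))"
    have F'_F: "F' \<subseteq> F" unfolding F'_def by auto
    obtain x where x: "x \<in> space M" "\<And>A. A \<in> F' \<Longrightarrow> x \<in> A"
    proof (rule complete_systems_common_point[OF S, where I=UNIV and T=T and F=F'])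
      show "F' \<inter> C \<noteq> {}" if "i \<in> UNIV" "C \<in> T i" for i C
      proof -
        have "F \<inter> C \<noteq> {}" using F(2) that unfolding S'_def by simp
        with that show ?thesis unfolding F'_def by auto
      qed
      show "fip_on (space M) F'" by (rule fip_on_mono[OF F(3) F'_F])
      show "F' \<subseteq> (\<Union>i\<in>UNIV. \<Union>(T i))" unfolding F'_def by simp
    qed (use T in auto)
    have "D i \<in> S'" for i unfolding S'_def using T(3)[of i] by (intro insertI2 UN_I[of i]) auto
    with F(2) have "F \<inter> D i \<noteq> {}" for i by simp
    then obtain d where d: "\<And>i. d i \<in> F" "\<And>i. d i \<in> D i"
      unfolding ex_in_conv[symmetric] Int_iff by metis
    have xd: "x \<in> d i" for i
      using x(2)[of "d i"] d T(3)[of i] unfolding F'_def by blast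
    have "x \<in> A" if A: "A \<in> F" for A
    proof (cases "A \<in> F'")
      case False
      with A F(1) have "A \<in> E" unfolding F'_def S'_def by blast
      then consider "A = space M - (\<Union>i. B i)" | k where "A = disjointed B k"
        unfolding E_def by blast
      thus ?thesis
      proof cases
        case 1
        have "x \<notin> B i" for i
        proof -
          have "space M \<inter> \<Inter>{A, d i} \<noteq> {}"
            using F(3)[unfolded fip_on_def, rule_format, of "{A, d i}"] A d(1) by simp
          hence "\<not> d i \<subseteq> B i" using 1 by auto
          hence "d i \<inter> B i = {}" using T(4)[of i] d(2)[of i] unfolding decides_def by blast
          with xd[of i] show ?thesis by blast
        qed
        with 1 x(1) show ?thesis by simp
      next
        case 2
        have meet: "space M \<inter> \<Inter>{A, d i} \<noteq> {}" for i
          using F(3)[unfolded fip_on_def, rule_format, of "{A, d i}"] A d(1) by simp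
        have "x \<in> B k"
        proof -
          have "d k \<inter> B k \<noteq> {}" using meet[of k] 2 disjointed_subset[of B k] by auto
          hence "d k \<subseteq> B k" using T(4)[of k] d(2)[of k] unfolding decides_def by blast
          with xd[of k] show ?thesis by blast
        qed
        moreover have "x \<notin> B i" if "i < k" for i
        proof -
          have "\<not> d i \<subseteq> B i" using meet[of i] 2 that unfolding disjointed_def by auto
          hence "d i \<inter> B i = {}" using T(4)[of i] d(2)[of i] unfolding decides_def by blast
          with xd[of i] show ?thesis by blast
        qed
        ultimately show ?thesis using 2 unfolding disjointed_def by auto
      qed
    qed (use x in auto)
    with x(1) show "space M \<inter> \<Inter>F \<noteq> {}" by blast
  qed
  moreover have "S \<subseteq> S'" using T(2) unfolding S'_def by blast
  moreover have "decides E (\<Union>i. B i)"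
    unfolding decides_def E_def using disjointed_subset[of B] by blast
  moreover have "E \<in> S'" unfolding S'_def by auto
  ultimately show ?thesis unfolding decidable_def by blast
qed

text \<open>Cantor's intersection theorem: the cells are closed, and a family that meets every cover
  contains cells inside balls of arbitrarily small radius.\<close>

lemma (in Metric_space) complete_system_closed:
  assumes "mcomplete" "space M' = M"
    and "countable S" "\<And>C. C \<in> S \<Longrightarrow> countable C \<and> C \<subseteq> sets M' \<and> M \<subseteq> \<Union>C"
    and closed: "\<And>C A. C \<in> S \<Longrightarrow> A \<in> C \<Longrightarrow> closedin mtopology A"
    and small: "\<And>e. e > 0 \<Longrightarrow> \<exists>C\<in>S. \<forall>A\<in>C. \<exists>a. A \<subseteq> mcball a e"
  shows "complete_system M' S"
  unfolding complete_system_def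
proof (intro conjI allI impI ballI)
  fix F assume F: "F \<subseteq> \<Union>S" "\<forall>C\<in>S. F \<inter> C \<noteq> {}" "fip_on (space M') F"
  have "\<Inter>F \<noteq> {}"
  proof (rule mcomplete_fip[THEN iffD1, rule_format, OF assms(1)], intro conjI allI impI ballI)
    show "closedin mtopology A" if "A \<in> F" for A using closed F(1) that by blast
    show "\<exists>C a. C \<in> F \<and> C \<subseteq> mcball a e" if "e > 0" for e
    proof -
      obtain C where C: "C \<in> S" "\<forall>A\<in>C. \<exists>a. A \<subseteq> mcball a e" using small \<open>e > 0\<close> by metis
      moreover have "F \<inter> C \<noteq> {}" using F(2) C(1) by auto
      ultimately show ?thesis by auto
    qed
    show "\<Inter>A \<noteq> {}" if "finite A \<and> A \<subseteq> F" for A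
      using F(3) that unfolding fip_on_def by blast
  qed
  \<comment> \<open>The intersection of the empty family is \<open>UNIV\<close>; a member of
    \<open>F\<close> is needed to place the common point in \<open>M\<close>.\<close>
  moreover have "F \<noteq> {}" using small[of 1] F(2) by auto
  moreover have "A \<subseteq> M" if "A \<in> F" for A
    using closed[THEN closedin_subset] F(1) that by (metis UnionE subsetD topspace_mtopology)
  ultimately show "space M' \<inter> \<Inter>F \<noteq> {}" using assms(2) by blast
qed (use assms in auto)

lemma standard_borel_complete_system:
  assumes "standard_borel M"
  obtains S where "complete_system M S" "separating M S" "\<And>B. B \<in> sets M \<Longrightarrow> decidable M S B"
proof -
  obtain T where T: "completely_metrizable_space T" "second_countable T" "topspace T = space M"
    "sets M = sigma_sets (space M) {U. openin T U}" using assms unfolding standard_borel_def by auto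
  from T(1) obtain X d where X: "Metric_space X d" "Metric_space.mcomplete X d" "T = Metric_space.mtopology X d"
    unfolding completely_metrizable_space_def by auto
  interpret Metric_space X d by fact
  have XM: "X = space M" using T(3) X(3) by simp
  obtain \<B> where \<B>: "countable \<B>" "\<And>V. V \<in> \<B> \<Longrightarrow> openin T V"
    "\<And>U x. openin T U \<Longrightarrow> x \<in> U \<Longrightarrow> \<exists>V\<in>\<B>. x \<in> V \<and> V \<subseteq> U"
    using T(2) unfolding second_countable_def by metis
  have open_sets: "U \<in> sets M" if "openin T U" for U
    using that T(4) by (auto intro: sigma_sets.Basic)
  have closed_sets: "U \<in> sets M" if "closedin T U" for U
  proof -
    have "space M - (space M - U) \<in> sets M"
      using that T(3) unfolding closedin_def by (intro sets.compl_sets open_sets) auto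
    moreover have "U \<subseteq> space M" using closedin_subset[OF that] T(3) by simp
    ultimately show ?thesis by (simp add: double_diff)
  qed
  have cl_small: "\<exists>V\<in>\<B>. x \<in> T closure_of V \<and> T closure_of V \<subseteq> mcball x e"
    if "x \<in> X" "e > 0" for x e
  proof -
    obtain V where V: "V \<in> \<B>" "x \<in> V" "V \<subseteq> mball x e"
      using \<B>(3)[of "mball x e" x] \<open>x \<in> X\<close> \<open>e > 0\<close> X(3) centre_in_mball_iff openin_mball by metis
    have "V \<subseteq> mcball x e" using V(3) mball_subset_mcball by blast
    hence "T closure_of V \<subseteq> mcball x e" using X(3) by (simp add: closure_of_minimal)
    moreover have "x \<in> T closure_of V"
      using closure_of_subset[OF openin_subset[OF \<B>(2)[OF V(1)]]] V(2) by blast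
    ultimately show ?thesis using V(1) by blast
  qed
  \<comment> \<open>Closures of basic open sets are closed, as completeness demands, and by
    \<open>cl_small\<close> the small ones still cover the space.\<close>
  define K where "K n = {T closure_of V | V. V \<in> \<B> \<and> (\<exists>a. T closure_of V \<subseteq> mcball a (1 / Suc n))}" for n :: nat
  define S where "S = range K"
  have K: "countable (K n)" "K n \<subseteq> sets M" "X \<subseteq> \<Union>(K n)" for n
  proof -
    have "K n \<subseteq> (\<lambda>V. T closure_of V) ` \<B>" unfolding K_def by blast
    with \<B>(1) show "countable (K n)" by (meson countable_image countable_subset)
    show "K n \<subseteq> sets M" unfolding K_def using closed_sets by auto
    show "X \<subseteq> \<Union>(K n)" unfolding K_def using cl_small[of _ "1 / Suc n"] by fastforce
  qed
  have K_closed: "closedin T A" if "A \<in> K n" for A n using that unfolding K_def by auto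
  have K_small: "\<exists>n. \<forall>A\<in>K n. \<exists>a. A \<subseteq> mcball a e" if "e > 0" for e
  proof -
    obtain n where n: "1 / Suc n < e" using nat_approx_posE[OF \<open>e > 0\<close>] by auto
    have "mcball a (1 / Suc n) \<subseteq> mcball a e" for a using n by (intro mcball_subset_concentric) auto
    thus ?thesis unfolding K_def by (intro exI[of _ n]) blast
  qed
  have sys: "complete_system M (S \<union> S')"
    if S'1: "countable S'"
      and S'2: "\<And>C. C \<in> S' \<Longrightarrow> countable C \<and> (\<forall>A\<in>C. closedin T A) \<and> X \<subseteq> \<Union>C" for S'
  proof (rule complete_system_closed)
    show "countable (S \<union> S')" using S'1 unfolding S_def by auto
    show "countable C \<and> C \<subseteq> sets M \<and> X \<subseteq> \<Union>C" if C: "C \<in> S \<union> S'" for C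
    proof (cases "C \<in> S")
      case True
      then obtain n where "C = K n" unfolding S_def by auto
      thus ?thesis using K[of n] by simp
    next
      case False
      with S'2[of C] C show ?thesis using closed_sets by auto
    qed
    show "closedin mtopology A" if C: "C \<in> S \<union> S'" and A: "A \<in> C" for C A
      using C A S'2[of C] K_closed[of A] X(3) unfolding S_def by auto
    show "\<exists>C\<in>S \<union> S'. \<forall>A\<in>C. \<exists>a. A \<subseteq> mcball a e" if "e > 0" for e
      using K_small[OF that] unfolding S_def by auto
  qed (use X XM in auto)
  have S: "complete_system M S" using sys[of "{}"] by simp
  have sep: "separating M S"
    unfolding separating_def
  proof (intro ballI impI)
    fix x y assume xy: "x \<in> space M" "y \<in> space M" "x \<noteq> y"
    hence pos: "d x y > 0" using XM by simp
    \<comment> \<open>Two cells of radius \<open>r\<close> with a common point would give a distance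
      of at most \<open>4 * r\<close> between \<open>x\<close> and \<open>y\<close>; any divisor
      above 4 rules this out.\<close>
    obtain n where n: "\<forall>A\<in>K n. \<exists>a. A \<subseteq> mcball a (d x y / 5)" using K_small[of "d x y / 5"] pos by auto
    have "A \<inter> B = {}" if AB: "A \<in> K n" "B \<in> K n" "x \<in> A" "y \<in> B" for A B
    proof (rule ccontr)
      assume "A \<inter> B \<noteq> {}"
      then obtain z where z: "z \<in> A" "z \<in> B" by blast
      obtain a b where ab: "A \<subseteq> mcball a (d x y / 5)" "B \<subseteq> mcball b (d x y / 5)" using n AB by meson
      have "d x z \<le> d a x + d a z" "d y z \<le> d b y + d b z"
        using z ab AB by (auto intro!: triangle'' simp: subset_iff)
      moreover have "d a x \<le> d x y / 5" "d a z \<le> d x y / 5" "d b y \<le> d x y / 5" "d b z \<le> d x y / 5"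
        using z ab AB by auto
      moreover have "d x y \<le> d x z + d y z"
        using xy z(1) ab(1) by (intro triangle') (simp_all add: XM[symmetric], meson in_mcball subsetD)
      ultimately show False using pos by linarith
    qed
    thus "\<exists>C\<in>S. \<forall>A\<in>C. \<forall>B\<in>C. x \<in> A \<longrightarrow> y \<in> B \<longrightarrow> A \<inter> B = {}" unfolding S_def by blast
  qed
  have "decidable M S B" if "B \<in> sets M" for B
    using that[unfolded T(4)]
  proof induction
    case (Basic U)
    hence U: "openin T U" by simp
    \<comment> \<open>Closed cells keep the system complete. By regularity the closures contained in
      \<open>U\<close> still exhaust \<open>U\<close>, and its complement is closed and can serve as
      a single cell.\<close>
    define C where "C = insert (space M - U) {T closure_of V | V. V \<in> \<B> \<and> T closure_of V \<subseteq> U}"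
    have "complete_system M (S \<union> {C})"
    proof (rule sys)
      fix C' assume "C' \<in> {C}"
      moreover have "countable {T closure_of V | V. V \<in> \<B> \<and> T closure_of V \<subseteq> U}"
        using \<B>(1) by (rule countable_subset[rotated, OF countable_image[of _ "\<lambda>V. T closure_of V"]]) auto
      moreover have "closedin T (space M - U)" using U T(3) by (metis closedin_diff closedin_topspace)
      moreover have "x \<in> \<Union>C" if x: "x \<in> X" for x
      proof (cases "x \<in> U")
        case True
        then obtain e where e: "e > 0" "mcball x e \<subseteq> U"
          using U X(3) openin_mtopology_mcball by metis
        obtain V where V: "V \<in> \<B>" "x \<in> T closure_of V" "T closure_of V \<subseteq> mcball x e"
          using cl_small[OF x e(1)] by metis
        have "T closure_of V \<subseteq> U" using V(3) e(2) by (rule subset_trans)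
        hence "T closure_of V \<in> C" using V(1) unfolding C_def by (intro insertI2 CollectI exI[of _ V]) simp
        with V(2) show ?thesis by auto
      qed (use x XM in \<open>auto simp: C_def\<close>)
      ultimately show "countable C' \<and> (\<forall>A\<in>C'. closedin T A) \<and> X \<subseteq> \<Union>C'"
        unfolding C_def by auto
    qed auto
    moreover have "decides C U" unfolding decides_def C_def by blast
    ultimately show ?case unfolding decidable_def by (intro exI[of _ "S \<union> {C}"]) auto
  next
    case Empty
    have "K 0 \<in> S" "decides (K 0) {}" unfolding S_def decides_def by auto
    with S show ?case unfolding decidable_def by (intro exI[of _ S]) auto
  next
    case (Compl a)
    thus ?case by (intro decidable_Compl)
  next
    case (Union a)
    thus ?case using T(4) by (intro decidable_UN[OF sep]) auto
  qed
  with S sep show thesis by (rule that)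
qed

lemma standard_borel_deciding_system:
  assumes "standard_borel M" "countable \<V>" "\<V> \<subseteq> sets M"
  obtains S where "complete_system M S" "separating M S" "\<And>B. B \<in> \<V> \<Longrightarrow> \<exists>C\<in>S. decides C B"
proof -
  obtain S0 where S0: "complete_system M S0" "separating M S0" "\<And>B. B \<in> sets M \<Longrightarrow> decidable M S0 B"
    using standard_borel_complete_system[OF assms(1)] by blast
  have "\<exists>S'. complete_system M S' \<and> S0 \<subseteq> S' \<and> (\<exists>C\<in>S'. decides C B)" if "B \<in> sets M" for B
    using S0(3)[OF that] unfolding decidable_def .
  then obtain T where T: "\<And>B. B \<in> sets M \<Longrightarrow> complete_system M (T B) \<and> S0 \<subseteq> T B \<and> (\<exists>C\<in>T B. decides C B)"
    by metis
  \<comment> \<open>The index \<open>{}\<close> keeps the family nonempty, so that \<open>S0\<close>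
    is contained in \<open>S\<close> even for empty \<open>\<V>\<close>.\<close>
  define S where "S = (\<Union>B\<in>insert {} \<V>. T B)"
  have "complete_system M S"
    unfolding S_def by (rule complete_system_countable_Union[OF S0(2)]) (use assms T in auto)
  moreover have "separating M S"
  proof -
    have "S0 \<subseteq> S" using T[of "{}"] unfolding S_def by auto
    thus ?thesis using S0(2) unfolding separating_def by (meson subsetD)
  qed
  moreover have "\<exists>C\<in>S. decides C B" if "B \<in> \<V>" for B
  proof -
    obtain C where "C \<in> T B" "decides C B" using T[of B] assms(3) \<open>B \<in> \<V>\<close> by auto
    with that show ?thesis unfolding S_def by auto
  qed
  ultimately show thesis by (rule that)
qed

lemma standard_borel_generator:
  assumes "standard_borel M"
  obtains \<V> where "countable \<V>" "\<V> \<subseteq> sets M" "sets M = sigma_sets (space M) \<V>"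
    "\<And>x y. x \<in> space M \<Longrightarrow> y \<in> space M \<Longrightarrow> (\<And>V. V \<in> \<V> \<Longrightarrow> x \<in> V \<longleftrightarrow> y \<in> V) \<Longrightarrow> x = y"
proof -
  obtain T where T: "completely_metrizable_space T" "second_countable T" "topspace T = space M"
    "sets M = sigma_sets (space M) {U. openin T U}" using assms unfolding standard_borel_def by auto
  obtain \<B> where \<B>: "countable \<B>" "\<And>V. V \<in> \<B> \<Longrightarrow> openin T V"
    "\<And>U x. openin T U \<Longrightarrow> x \<in> U \<Longrightarrow> \<exists>V\<in>\<B>. x \<in> V \<and> V \<subseteq> U"
    using T(2) unfolding second_countable_def by metis
  have "Hausdorff_space T"
    using T(1) completely_metrizable_imp_metrizable_space metrizable_imp_Hausdorff_space by auto
  show thesis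
  proof
    show "countable \<B>" by fact
    show sub: "\<B> \<subseteq> sets M" using \<B>(2) T(4) by (auto intro: sigma_sets.Basic)
    show "sets M = sigma_sets (space M) \<B>"
    proof
      show "sigma_sets (space M) \<B> \<subseteq> sets M" using sub by (rule sets.sigma_sets_subset)
      have "U \<in> sigma_sets (space M) \<B>" if U: "openin T U" for U
      proof -
        have "(\<Union>V\<in>{V \<in> \<B>. V \<subseteq> U}. V) \<in> sigma_sets (space M) \<B>"
          using \<B>(1) by (intro sigma_sets_UNION sigma_sets.Basic) auto
        moreover have "(\<Union>V\<in>{V \<in> \<B>. V \<subseteq> U}. V) = U"
        proof (intro equalityI subsetI)
          fix x assume "x \<in> U"
          then obtain V where "V \<in> \<B>" "x \<in> V" "V \<subseteq> U" using \<B>(3)[OF U] by metis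
          thus "x \<in> (\<Union>V\<in>{V \<in> \<B>. V \<subseteq> U}. V)" by auto
        qed auto
        ultimately show ?thesis by simp
      qed
      thus "sets M \<subseteq> sigma_sets (space M) \<B>"
        unfolding T(4) by (intro sigma_sets_mono) auto
    qed
    fix x y assume xy: "x \<in> space M" "y \<in> space M" "\<And>V. V \<in> \<B> \<Longrightarrow> x \<in> V \<longleftrightarrow> y \<in> V"
    show "x = y"
    proof (rule ccontr)
      assume "x \<noteq> y"
      then obtain U W where "openin T U" "openin T W" "x \<in> U" "y \<in> W" "disjnt U W"
        using \<open>Hausdorff_space T\<close> xy(1,2) T(3) unfolding Hausdorff_space_def by metis
      moreover then obtain V where "V \<in> \<B>" "x \<in> V" "V \<subseteq> U" using \<B>(3) by metis
      ultimately show False using xy(3)[of V] unfolding disjnt_def by auto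
    qed
  qed
qed

section \<open>Borel sections modulo null sets\<close>

text \<open>Dependent choice of shrinking members of \<open>L\<close>, one family of
  \<open>\<D>\<close> at a time. The families outside \<open>S\<close> need not be covers, which
  allows extra demands on the limit. The limit lies in the chosen cells, but perhaps in no member of
  \<open>L\<close>; the member inside \<open>A \<inter> R0\<close> is what later ties the cell
  \<open>A\<close> to the pieces.\<close>

lemma complete_system_branch:
  assumes sys: "complete_system M S" and \<D>: "countable \<D>" "S \<subseteq> \<D>" "\<Union>\<D> \<subseteq> \<Union>S"
    and R0: "R0 \<in> L"
    and L: "\<And>R. R \<in> L \<Longrightarrow> R \<noteq> {}" "\<And>R. R \<in> L \<Longrightarrow> R \<subseteq> space M"
    and refine: "\<And>R C. R \<in> L \<Longrightarrow> C \<in> \<D> \<Longrightarrow> \<exists>A\<in>C. R \<inter> A \<in> L"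
  obtains a where "a \<in> space M" "\<And>C. C \<in> \<D> \<Longrightarrow> \<exists>A\<in>C. a \<in> A \<and> (\<exists>R\<in>L. R \<subseteq> A \<inter> R0)"
proof (cases "\<D> = {}")
  case True
  obtain a where "a \<in> R0" using L(1)[OF R0] by auto
  with L(2)[OF R0] True that show thesis by auto
next
  case False
  define D where "D = from_nat_into \<D>"
  have D: "D n \<in> \<D>" for n unfolding D_def using False by (rule from_nat_into)
  \<comment> \<open>The second component records the cell chosen at the preceding stage; at stage 0
    it is arbitrary.\<close>
  define P where "P n = (\<lambda>(R, A). R \<in> L \<and> R \<subseteq> R0 \<and> (\<forall>m. n = Suc m \<longrightarrow> A \<in> D m \<and> R \<subseteq> A))"
    for n :: nat
  have "\<exists>f. \<forall>n. P n (f n) \<and> fst (f (Suc n)) \<subseteq> fst (f n)"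
  proof (rule dependent_nat_choice)
    show "\<exists>p. P 0 p" unfolding P_def using R0 by auto
    fix p n assume p: "P n p"
    obtain A where "A \<in> D n" "fst p \<inter> A \<in> L"
      using refine[of "fst p" "D n"] D p unfolding P_def by (auto split: prod.splits)
    thus "\<exists>q. P (Suc n) q \<and> fst q \<subseteq> fst p"
      using p unfolding P_def by (intro exI[of _ "(fst p \<inter> A, A)"]) (auto split: prod.splits)
  qed
  then obtain f where f: "\<And>n. P n (f n)" "\<And>n. fst (f (Suc n)) \<subseteq> fst (f n)" by metis
  define R where "R n = fst (f n)" for n
  define A where "A n = snd (f (Suc n))" for n
  have R: "R n \<in> L" "R n \<subseteq> R0" for n using f(1)[of n] unfolding P_def R_def by auto
  have A: "A n \<in> D n" "R (Suc n) \<subseteq> A n" for n using f(1)[of "Suc n"] unfolding P_def R_def A_def by auto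
  have anti: "R n \<subseteq> R m" if "m \<le> n" for m n
    using that by (rule lift_Suc_antimono_le[rotated]) (use f(2) R_def in auto)
  obtain a where a: "a \<in> space M" "\<And>B. B \<in> range A \<Longrightarrow> a \<in> B"
  proof (rule complete_systemE[OF sys])
    have "A n \<in> \<Union>\<D>" for n using A(1)[of n] D[of n] by auto
    thus "range A \<subseteq> \<Union>S" using \<D>(3) by auto
    show "range A \<inter> C \<noteq> {}" if C: "C \<in> S" for C
    proof -
      obtain n where "D n = C"
        unfolding D_def using from_nat_into_surj[OF \<D>(1), of C] C \<D>(2) by auto
      with A(1)[of n] show ?thesis by auto
    qed
    show "fip_on (space M) (range A)"
      unfolding fip_on_def
    proof (intro allI impI)
      fix F assume F: "finite F \<and> F \<subseteq> range A"
      then obtain I where I: "finite I" "F = A ` I" using finite_subset_image by metis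
      obtain N where N: "\<And>i. i \<in> I \<Longrightarrow> i < N" using I(1) unfolding finite_nat_set_iff_bounded by auto
      have "R N \<subseteq> A i" if "i \<in> I" for i
        using A(2)[of i] anti[of "Suc i" N] N[OF that] by auto
      hence "R N \<subseteq> space M \<inter> \<Inter>F" using L(2)[OF R(1)[of N]] I(2) by auto
      with L(1)[OF R(1)[of N]] subset_empty show "space M \<inter> \<Inter>F \<noteq> {}" by metis
    qed
  qed auto
  show thesis
  proof (rule that[OF a(1)])
    fix C assume C: "C \<in> \<D>"
    obtain n where n: "D n = C" unfolding D_def using from_nat_into_surj[OF \<D>(1) C] by auto
    show "\<exists>A\<in>C. a \<in> A \<and> (\<exists>R\<in>L. R \<subseteq> A \<inter> R0)"
      using n A[of n] R[of "Suc n"] a(2)[of "A n"]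
      by (intro bexI[of _ "A n"] conjI bexI[of _ "R (Suc n)"]) auto
  qed
qed

section \<open>Negligible sets and essential domains over a finite measure space\<close>

locale borel_fibration = finite_measure \<mu> for \<mu> :: "'b measure" +
  fixes M :: "'a measure" and s :: "'a \<Rightarrow> 'b" and \<V> :: "'b set set"
  assumes standard_M: "standard_borel M"
    and s_measurable [measurable]: "s \<in> measurable M \<mu>"
    and countable_\<V>: "countable \<V>"
    and \<V>_sets: "\<V> \<subseteq> sets \<mu>"
    and \<V>_separates: "x \<in> space \<mu> \<Longrightarrow> y \<in> space \<mu> \<Longrightarrow> (\<And>V. V \<in> \<V> \<Longrightarrow> x \<in> V \<longleftrightarrow> y \<in> V) \<Longrightarrow> x = y"
begin

definition over :: "'b set \<Rightarrow> 'a set" where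
  "over D = s -` D \<inter> space M"

lemma over_sets [measurable]: "D \<in> sets \<mu> \<Longrightarrow> over D \<in> sets M"
  unfolding over_def by measurable

lemma over_UN: "over (\<Union>i\<in>I. D i) = (\<Union>i\<in>I. over (D i))"
  and over_empty: "over {} = {}"
  unfolding over_def by auto

lemma over_space: "over (space \<mu>) = space M"
  using measurable_space[OF s_measurable] unfolding over_def by auto

definition sigma_ideal :: "('a set \<Rightarrow> bool) \<Rightarrow> bool" where
  "sigma_ideal J \<longleftrightarrow> (\<forall>A B. J B \<longrightarrow> A \<subseteq> B \<longrightarrow> J A) \<and>
     (\<forall>A :: nat \<Rightarrow> 'a set. (\<forall>n. J (A n)) \<longrightarrow> J (\<Union>n. A n)) \<and> (\<forall>N\<in>null_sets \<mu>. J (over N))"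

lemma sigma_idealD:
  assumes "sigma_ideal J"
  shows "J B \<Longrightarrow> A \<subseteq> B \<Longrightarrow> J A"
    and "(\<And>n. J (C n)) \<Longrightarrow> J (\<Union>n :: nat. C n)"
    and "N \<in> null_sets \<mu> \<Longrightarrow> J (over N)"
  using assms unfolding sigma_ideal_def by simp_all

lemma sigma_ideal_empty: "sigma_ideal J \<Longrightarrow> J {}"
  using sigma_idealD(3)[of J "{}"] by (simp add: over_empty)

lemma sigma_ideal_UN:
  assumes J: "sigma_ideal J" and "countable I" "\<And>i. i \<in> I \<Longrightarrow> J (A i)"
  shows "J (\<Union>i\<in>I. A i)"
proof (cases "I = {}")
  case False
  hence "range (from_nat_into I) = I" using assms(2) by (rule range_from_nat_into)
  moreover have "(\<Union>n. A (from_nat_into I n)) = (\<Union>i\<in>range (from_nat_into I). A i)" by auto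
  ultimately have "(\<Union>n. A (from_nat_into I n)) = (\<Union>i\<in>I. A i)" by simp
  moreover have "J (\<Union>n. A (from_nat_into I n))"
    using assms(3) from_nat_into[OF False] by (intro sigma_idealD(2)[OF J]) auto
  ultimately show ?thesis by simp
qed (simp add: sigma_ideal_empty[OF J])

lemma sigma_ideal_Un:
  assumes J: "sigma_ideal J" and "J A" "J B"
  shows "J (A \<union> B)"
  using sigma_ideal_UN[OF J, of "{A, B}" "\<lambda>x. x"] assms(2,3) by auto

text \<open>The admissible sets are closed under countable intersections, so the infimum of their
  measures is attained by some \<open>D'\<close>. If an admissible \<open>E\<close> cut off a set of
  positive measure, \<open>D' \<inter> E\<close> would have a smaller measure.\<close>

lemma essential_domain_exists:
  assumes J: "sigma_ideal J" and R: "R \<subseteq> space M"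
  obtains D where "D \<in> sets \<mu>" "J (R - over D)"
    "\<And>E. E \<in> sets \<mu> \<Longrightarrow> J (R - over E) \<Longrightarrow> D - E \<in> null_sets \<mu>"
proof -
  define Q where "Q = {D \<in> sets \<mu>. J (R - over D)}"
  define m where "m = (INF D\<in>Q. measure \<mu> D)"
  have "R - over (space \<mu>) = {}" using R over_space by auto
  hence "J (R - over (space \<mu>))" using sigma_ideal_empty[OF J] by (simp only:)
  hence ne: "space \<mu> \<in> Q" unfolding Q_def by auto
  have lower: "m \<le> measure \<mu> D" if "D \<in> Q" for D
    unfolding m_def using that by (intro cINF_lower bdd_belowI[of _ 0]) auto
  have "\<exists>D\<in>Q. measure \<mu> D < m + 1 / Suc n" for n
    unfolding m_def using ne by (intro cINF_less_iff[THEN iffD1] bdd_belowI[of _ 0]) auto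
  then obtain D where D: "\<And>n :: nat. D n \<in> Q" "\<And>n. measure \<mu> (D n) < m + 1 / Suc n" by metis
  define D' where "D' = (\<Inter>n. D n)"
  have D'_sets: "D' \<in> sets \<mu>" unfolding D'_def using D(1) Q_def by auto
  have "R - over D' = (\<Union>n. R - over (D n))" unfolding D'_def over_def by auto
  moreover have "J (\<Union>n. R - over (D n))" using D(1) Q_def by (intro sigma_idealD(2)[OF J]) auto
  ultimately have JD': "J (R - over D')" by simp
  have le: "measure \<mu> D' \<le> m"
  proof (rule field_le_epsilon)
    fix e :: real assume "e > 0"
    then obtain n where n: "1 / Suc n < e" using nat_approx_posE by metis
    have "measure \<mu> D' \<le> measure \<mu> (D n)"
      using D(1)[of n] unfolding D'_def Q_def by (intro finite_measure_mono) auto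
    with D(2)[of n] n show "measure \<mu> D' \<le> m + e" by linarith
  qed
  have "D' - E \<in> null_sets \<mu>" if E: "E \<in> sets \<mu>" "J (R - over E)" for E
  proof -
    have "R - over (D' \<inter> E) = (R - over D') \<union> (R - over E)" unfolding over_def by auto
    hence "D' \<inter> E \<in> Q"
      unfolding Q_def using sigma_ideal_Un[OF J JD' E(2)] D'_sets E(1) by auto
    from lower[OF this] le have "measure \<mu> (D' - E) \<le> 0"
      using finite_measure_Diff'[OF D'_sets E(1)] by simp
    hence "emeasure \<mu> (D' - E) = 0"
      unfolding emeasure_eq_measure using measure_nonneg[of \<mu> "D' - E"] by simp
    with D'_sets E(1) show ?thesis by (intro null_setsI) auto
  qed
  with D'_sets JD' that show thesis by blast
qed

end

text \<open>\<open>D R\<close> is the essentially smallest Borel set off which \<open>R\<close> is negligible. A piece \<open>R\<close> is large over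
  \<open>x\<close> if \<open>x \<in> D R\<close>.\<close>

locale fibration_ideal = borel_fibration \<mu> M s \<V>
  for \<mu> :: "'b measure" and M :: "'a measure" and s :: "'a \<Rightarrow> 'b" and \<V> :: "'b set set" +
  fixes J :: "'a set \<Rightarrow> bool" and D :: "'a set \<Rightarrow> 'b set" and S :: "'a set set set"
  assumes J: "sigma_ideal J"
    and D_sets [measurable]: "R \<in> sets M \<Longrightarrow> D R \<in> sets \<mu>"
    and D_J: "R \<in> sets M \<Longrightarrow> J (R - over (D R))"
    and D_minimal: "R \<in> sets M \<Longrightarrow> E \<in> sets \<mu> \<Longrightarrow> J (R - over E) \<Longrightarrow> D R - E \<in> null_sets \<mu>"
    and S_complete: "complete_system M S"
    and S_separating: "separating M S"
    and S_decides: "V \<in> \<V> \<Longrightarrow> \<exists>C\<in>S. decides C (over V)"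
begin

lemma countable_S: "countable S"
  and S_cover: "C \<in> S \<Longrightarrow> countable C" "C \<in> S \<Longrightarrow> A \<in> C \<Longrightarrow> A \<in> sets M"
    "C \<in> S \<Longrightarrow> a \<in> space M \<Longrightarrow> \<exists>A\<in>C. a \<in> A"
  using complete_systemD[OF S_complete] by (simp, simp, blast, meson Union_iff subsetD)

lemma countable_cells: "countable (\<Union>S)"
  using countable_S S_cover(1) countable_UN[of S "\<lambda>C. C"] by simp

lemma cell_sets [measurable]: "A \<in> \<Union>S \<Longrightarrow> A \<in> sets M"
  using S_cover(2) by auto

lemma AE_D_subset:
  assumes "R \<in> sets M" "E \<in> sets \<mu>" "J (R - over E)"
  shows "AE x in \<mu>. x \<in> D R \<longrightarrow> x \<in> E"
  using AE_not_in[OF D_minimal[OF assms]] by eventually_elim auto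

text \<open>Off the union of the sets \<open>D (R \<inter> A)\<close>, the piece \<open>R\<close> is
  a countable union of negligible sets; minimality of \<open>D R\<close> does the rest.\<close>

lemma AE_D_refine:
  assumes R: "R \<in> sets M" and C: "C \<in> S"
  shows "AE x in \<mu>. x \<in> D R \<longrightarrow> (\<exists>A\<in>C. x \<in> D (R \<inter> A))"
proof -
  have "AE x in \<mu>. x \<in> D R \<longrightarrow> x \<in> (\<Union>A\<in>C. D (R \<inter> A))"
  proof (rule AE_D_subset[OF R])
    show "(\<Union>A\<in>C. D (R \<inter> A)) \<in> sets \<mu>"
      using S_cover(1,2)[OF C] R by (intro sets.countable_UN'') auto
    have "R - over (\<Union>A\<in>C. D (R \<inter> A)) \<subseteq> (\<Union>A\<in>C. R \<inter> A - over (D (R \<inter> A)))"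
    proof
      fix a assume a: "a \<in> R - over (\<Union>A\<in>C. D (R \<inter> A))"
      have "a \<in> space M" using a sets.sets_into_space[OF R] by auto
      then obtain A where "A \<in> C" "a \<in> A" using S_cover(3)[OF C] by auto
      with a show "a \<in> (\<Union>A\<in>C. R \<inter> A - over (D (R \<inter> A)))" unfolding over_UN by auto
    qed
    moreover have "J (\<Union>A\<in>C. R \<inter> A - over (D (R \<inter> A)))"
      using S_cover(1,2)[OF C] R by (intro sigma_ideal_UN[OF J] D_J) auto
    ultimately show "J (R - over (\<Union>A\<in>C. D (R \<inter> A)))" using sigma_idealD(1)[OF J] by blast
  qed
  thus ?thesis by simp
qed

lemma AE_D_over:
  assumes R: "R \<in> sets M" and V: "V \<in> sets \<mu>"
  shows "AE x in \<mu>. x \<in> D R \<longrightarrow> R \<noteq> {} \<and> (R \<subseteq> over V \<longrightarrow> x \<in> V) \<and> (R \<inter> over V = {} \<longrightarrow> x \<notin> V)"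
proof -
  have *: "AE x in \<mu>. x \<in> D R \<longrightarrow> x \<in> E" if "E \<in> sets \<mu>" "R \<subseteq> over E" for E
  proof (rule AE_D_subset[OF R that(1)])
    have "R - over E = {}" using that(2) by auto
    thus "J (R - over E)" using sigma_ideal_empty[OF J] by (simp only:)
  qed
  have "AE x in \<mu>. x \<in> D R \<longrightarrow> R \<noteq> {}"
  proof (cases "R = {}")
    case True
    with *[of "{}"] show ?thesis by auto
  qed auto
  moreover have "AE x in \<mu>. x \<in> D R \<longrightarrow> R \<subseteq> over V \<longrightarrow> x \<in> V"
  proof (cases "R \<subseteq> over V")
    case True
    with *[OF V] show ?thesis by auto
  qed auto
  moreover have "AE x in \<mu>. x \<in> D R \<longrightarrow> R \<inter> over V = {} \<longrightarrow> x \<notin> V"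
  proof (cases "R \<inter> over V = {}")
    case True
    have "R \<subseteq> over (space \<mu> - V)"
    proof
      fix a assume a: "a \<in> R"
      hence "a \<in> space M" using sets.sets_into_space[OF R] by auto
      with True a show "a \<in> over (space \<mu> - V)"
        using measurable_space[OF s_measurable] unfolding over_def by auto
    qed
    from *[OF _ this] V have "AE x in \<mu>. x \<in> D R \<longrightarrow> x \<in> space \<mu> - V" by auto
    thus ?thesis by eventually_elim auto
  qed auto
  ultimately show ?thesis by eventually_elim auto
qed

text \<open>There are countably many, so that almost every \<open>x\<close> satisfies the almost
  sure statements for all of them at once.\<close>

definition pieces :: "'a set \<Rightarrow> 'a set set" where
  "pieces B = (\<lambda>A. B \<inter> \<Inter>A) ` {A. finite A \<and> A \<subseteq> \<Union>S}"

lemma countable_pieces: "countable (pieces B)"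
  unfolding pieces_def by (intro countable_image countable_Collect_finite_subset countable_cells)

lemma pieces_self: "B \<in> pieces B"
  unfolding pieces_def by (rule image_eqI[of _ _ "{}"]) auto

lemma pieces_Int:
  assumes "R \<in> pieces B" "A \<in> \<Union>S"
  shows "R \<inter> A \<in> pieces B"
proof -
  obtain F where "finite F" "F \<subseteq> \<Union>S" "R = B \<inter> \<Inter>F" using assms(1) unfolding pieces_def by auto
  with assms(2) show ?thesis unfolding pieces_def by (intro image_eqI[of _ _ "insert A F"]) auto
qed

lemma pieces_sets:
  assumes "B \<in> sets M" "R \<in> pieces B"
  shows "R \<in> sets M"
proof -
  obtain F where F: "finite F" "F \<subseteq> \<Union>S" "R = B \<inter> \<Inter>F" using assms(2) unfolding pieces_def by auto
  have "B \<inter> \<Inter>F \<in> sets M"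
    using F(1,2)
  proof induction
    case (insert A F)
    have "B \<inter> \<Inter>F \<inter> A \<in> sets M"
      using insert.IH insert.prems cell_sets[of A] by (intro sets.Int[of "B \<inter> \<Inter>F"]) simp_all
    thus ?case by (simp add: Int_ac)
  qed (use assms in simp)
  with F(3) show ?thesis by simp
qed

definition generic :: "'a set \<Rightarrow> 'b \<Rightarrow> bool" where
  "generic B x \<longleftrightarrow> (\<forall>R\<in>pieces B. x \<in> D R \<longrightarrow> R \<noteq> {} \<and> (\<forall>C\<in>S. \<exists>A\<in>C. x \<in> D (R \<inter> A)) \<and>
     (\<forall>V\<in>\<V>. (R \<subseteq> over V \<longrightarrow> x \<in> V) \<and> (R \<inter> over V = {} \<longrightarrow> x \<notin> V)))"

lemma AE_generic:
  assumes B: "B \<in> sets M"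
  shows "AE x in \<mu>. generic B x"
proof -
  have piece: "AE x in \<mu>. x \<in> D R \<longrightarrow> R \<noteq> {} \<and> (\<forall>C\<in>S. \<exists>A\<in>C. x \<in> D (R \<inter> A)) \<and>
     (\<forall>V\<in>\<V>. (R \<subseteq> over V \<longrightarrow> x \<in> V) \<and> (R \<inter> over V = {} \<longrightarrow> x \<notin> V))"
    if "R \<in> pieces B" for R
  proof -
    have R: "R \<in> sets M" by (rule pieces_sets[OF B that])
    have "AE x in \<mu>. \<forall>C\<in>S. x \<in> D R \<longrightarrow> (\<exists>A\<in>C. x \<in> D (R \<inter> A))"
      by (intro AE_ball_countable[THEN iffD2] ballI AE_D_refine[OF R] countable_S)
    moreover have "AE x in \<mu>. \<forall>V\<in>\<V>. x \<in> D R \<longrightarrow>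
        R \<noteq> {} \<and> (R \<subseteq> over V \<longrightarrow> x \<in> V) \<and> (R \<inter> over V = {} \<longrightarrow> x \<notin> V)"
      by (intro AE_ball_countable[THEN iffD2] ballI AE_D_over[OF R] countable_\<V>)
         (use \<V>_sets in auto)
    moreover have "AE x in \<mu>. x \<in> D R \<longrightarrow> R \<noteq> {}"
      using AE_D_over[OF R sets.empty_sets] by eventually_elim simp
    ultimately show ?thesis by eventually_elim blast
  qed
  show ?thesis
    unfolding generic_def by (intro AE_ball_countable[THEN iffD2] ballI piece countable_pieces)
qed

text \<open>The limit \<open>a\<close> of a branch of pieces large over \<open>x\<close> is forced
  into the fibre of \<open>x\<close>: for each \<open>V\<close> it lies in a cell on one side of
  \<open>over V\<close>, this cell contains a large piece, and genericity puts \<open>x\<close> on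
  the same side of \<open>V\<close>. The cover \<open>C0\<close> puts \<open>a\<close> into
  \<open>B\<close> in the same way.\<close>

lemma generic_fibre_point:
  assumes B: "B \<in> sets M" and dec: "C0 \<in> S" "decides C0 B"
    and x: "generic B x" "x \<in> space \<mu>" "x \<in> D B"
    and \<D>: "countable \<D>" "\<Union>\<D> \<subseteq> \<Union>S"
    and refine: "\<And>R C. R \<in> pieces B \<Longrightarrow> x \<in> D R \<Longrightarrow> C \<in> \<D> \<Longrightarrow> \<exists>A\<in>C. x \<in> D (R \<inter> A)"
  obtains a where "a \<in> B" "s a = x" "\<And>C. C \<in> \<D> \<Longrightarrow> \<exists>A\<in>C. a \<in> A"
proof -
  define L where "L = {R \<in> pieces B. x \<in> D R}"
  have L: "R \<noteq> {}" "\<And>C. C \<in> S \<Longrightarrow> \<exists>A\<in>C. x \<in> D (R \<inter> A)"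
     "\<And>V. V \<in> \<V> \<Longrightarrow> R \<subseteq> over V \<Longrightarrow> x \<in> V" "\<And>V. V \<in> \<V> \<Longrightarrow> R \<inter> over V = {} \<Longrightarrow> x \<notin> V" if "R \<in> L" for R
    using x(1) that unfolding generic_def L_def by auto
  obtain a where a: "a \<in> space M" "\<And>C. C \<in> S \<union> \<D> \<Longrightarrow> \<exists>A\<in>C. a \<in> A \<and> (\<exists>R\<in>L. R \<subseteq> A \<inter> B)"
  proof (rule complete_system_branch[OF S_complete, of "S \<union> \<D>" B L])
    show "countable (S \<union> \<D>)" using countable_S \<D> by auto
    show "\<Union> (S \<union> \<D>) \<subseteq> \<Union> S" using \<D> by auto
    show "B \<in> L" unfolding L_def using pieces_self x by auto
    show "R \<subseteq> space M" if "R \<in> L" for R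
      using that pieces_sets[OF B] sets.sets_into_space unfolding L_def by auto
    fix R C assume R: "R \<in> L" and C: "C \<in> S \<union> \<D>"
    have "\<exists>A\<in>C. x \<in> D (R \<inter> A)"
    proof (cases "C \<in> S")
      case False
      with C R refine[of R C] show ?thesis unfolding L_def by auto
    qed (use L(2)[OF R] in auto)
    then obtain A where A: "A \<in> C" "x \<in> D (R \<inter> A)" by auto
    have "A \<in> \<Union>S" using A(1) C \<D>(2) by auto
    with A R pieces_Int[of R B A] show "\<exists>A\<in>C. R \<inter> A \<in> L" unfolding L_def by auto
  qed (use L in auto)
  show thesis
  proof
    obtain A R where A: "A \<in> C0" "a \<in> A" "R \<in> L" "R \<subseteq> A \<inter> B" using a(2)[of C0] dec(1) by auto
    from A L(1)[of R] have "A \<inter> B \<noteq> {}" by auto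
    with dec(2) A(1) have "A \<subseteq> B" unfolding decides_def by auto
    with A(2) show "a \<in> B" by auto
    show "s a = x"
    proof (rule \<V>_separates)
      show "s a \<in> space \<mu>" using measurable_space[OF s_measurable a(1)] .
      show "x \<in> space \<mu>" by fact
      fix V assume V: "V \<in> \<V>"
      obtain C where C: "C \<in> S" "decides C (over V)" using S_decides[OF V] by auto
      obtain A R where A: "A \<in> C" "a \<in> A" "R \<in> L" "R \<subseteq> A \<inter> B" using a(2)[of C] C(1) by auto
      consider "A \<subseteq> over V" | "A \<inter> over V = {}" using C(2) A(1) unfolding decides_def by auto
      thus "s a \<in> V \<longleftrightarrow> x \<in> V"
      proof cases
        case 1
        have "x \<in> V" using L(3)[OF A(3) V] A(4) 1 by auto
        with 1 A(2) show ?thesis unfolding over_def by auto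
      next
        case 2
        have "x \<notin> V" using L(4)[OF A(3) V] A(4) 2 by auto
        with 2 A(2) a(1) show ?thesis unfolding over_def by auto
      qed
    qed
    show "\<exists>A\<in>C. a \<in> A" if "C \<in> \<D>" for C using a(2)[of C] that by auto
  qed
qed

end

section \<open>Images of Borel sets and Borel sections, modulo null sets\<close>

context borel_fibration
begin

lemma fibration_ideal_exists:
  assumes "sigma_ideal J" "B \<in> sets M"
  obtains D S C where "fibration_ideal \<mu> M s \<V> J D S" "C \<in> S" "decides C B"
proof -
  have "\<exists>D. D \<in> sets \<mu> \<and> J (R - over D) \<and> (\<forall>E\<in>sets \<mu>. J (R - over E) \<longrightarrow> D - E \<in> null_sets \<mu>)"
    if "R \<in> sets M" for R
    using essential_domain_exists[OF assms(1) sets.sets_into_space[OF that]] by metis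
  then obtain D where D: "\<And>R. R \<in> sets M \<Longrightarrow> D R \<in> sets \<mu> \<and> J (R - over (D R)) \<and>
      (\<forall>E\<in>sets \<mu>. J (R - over E) \<longrightarrow> D R - E \<in> null_sets \<mu>)" by metis
  have "countable (insert B (over ` \<V>))" "insert B (over ` \<V>) \<subseteq> sets M"
    using countable_\<V> \<V>_sets assms(2) by auto
  then obtain S where S: "complete_system M S" "separating M S"
      "\<And>A. A \<in> insert B (over ` \<V>) \<Longrightarrow> \<exists>C\<in>S. decides C A"
    using standard_borel_deciding_system[OF standard_M] by metis
  obtain C where C: "C \<in> S" "decides C B" using S(3)[of B] by auto
  have "fibration_ideal \<mu> M s \<V> J D S"
    by unfold_locales (use assms D S in auto)
  with C show thesis using that by blast
qed

text \<open>The measurability of analytic sets, for the measure at hand. With the ideal of the sets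
  that lie over null sets, \<open>D B\<close> is the image up to a null set: the part of
  \<open>B\<close> off it is negligible, and over a generic point of it a branch ends in
  \<open>B\<close>. No point has to be avoided, so the extra family \<open>\<D>\<close> is
  empty.\<close>

lemma image_measurable:
  assumes B: "B \<in> sets M"
  obtains D N where "D \<in> sets \<mu>" "N \<in> null_sets \<mu>" "D - N \<subseteq> s ` B" "s ` B \<subseteq> D \<union> N"
proof -
  define J where "J A \<longleftrightarrow> (\<exists>N\<in>null_sets \<mu>. A \<subseteq> over N)" for A
  have J: "sigma_ideal J"
    unfolding sigma_ideal_def
  proof (intro conjI allI impI ballI)
    fix A :: "nat \<Rightarrow> 'a set" assume "\<forall>n. J (A n)"
    then obtain N where N: "\<And>n. N n \<in> null_sets \<mu>" "\<And>n. A n \<subseteq> over (N n)" unfolding J_def by metis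
    have "(\<Union>n. N n) \<in> null_sets \<mu>" using N(1) by auto
    moreover have "(\<Union>n. A n) \<subseteq> over (\<Union>n. N n)" using N(2) unfolding over_UN by auto
    ultimately show "J (\<Union>n. A n)" unfolding J_def by auto
  qed (auto simp: J_def)
  obtain D S C where "fibration_ideal \<mu> M s \<V> J D S" and C: "C \<in> S" "decides C B"
    using fibration_ideal_exists[OF J B] .
  then interpret fibration_ideal \<mu> M s \<V> J D S by simp
  obtain N1 where N1: "N1 \<in> null_sets \<mu>" "B - over (D B) \<subseteq> over N1" using D_J[OF B] unfolding J_def by auto
  have "AE x in \<mu>. x \<in> D B \<longrightarrow> x \<in> s ` B"
    using AE_generic[OF B] AE_space
  proof eventually_elim
    fix x assume x: "generic B x" "x \<in> space \<mu>"
    show "x \<in> D B \<longrightarrow> x \<in> s ` B"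
    proof
      assume "x \<in> D B"
      with generic_fibre_point[OF B C x, of "{}"] show "x \<in> s ` B" by auto
    qed
  qed
  then obtain N2 where N2: "\<And>x. x \<in> space \<mu> - N2 \<Longrightarrow> x \<in> D B \<longrightarrow> x \<in> s ` B" "N2 \<in> null_sets \<mu>"
    by (elim AE_E3) blast
  show thesis
  proof
    show "D B \<in> sets \<mu>" using B by simp
    show "N1 \<union> N2 \<in> null_sets \<mu>" using N1 N2 by auto
    show "D B - (N1 \<union> N2) \<subseteq> s ` B" using N2(1) sets.sets_into_space[OF D_sets[OF B]] by auto
    show "s ` B \<subseteq> D B \<union> (N1 \<union> N2)"
      using N1(2) sets.sets_into_space[OF B] unfolding over_def by auto
  qed
qed

text \<open>The ideal consists of the sets that satisfy the conclusion. The points of a piece whose fibre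
  is not split by two disjoint large cells form a single section, so that every large piece splits.
  A branch of large cells can therefore avoid the points of a countable fibre one after the other,
  although its limit lies in the fibre.\<close>

theorem countable_sections:
  assumes countable: "\<And>x. x \<in> space \<mu> \<Longrightarrow> countable {a \<in> space M. s a = x}"
  obtains B :: "nat \<Rightarrow> 'a set" and N where "\<And>n. B n \<in> sets M" "\<And>n. inj_on s (B n)"
    "N \<in> null_sets \<mu>" "space M \<subseteq> (\<Union>n. B n) \<union> over N"
proof -
  define J where "J A \<longleftrightarrow> (\<exists>B :: nat \<Rightarrow> 'a set. \<exists>N\<in>null_sets \<mu>.
     (\<forall>n. B n \<in> sets M \<and> inj_on s (B n)) \<and> A \<subseteq> (\<Union>n. B n) \<union> over N)" for A
  have J: "sigma_ideal J"
    unfolding sigma_ideal_def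
  proof (intro conjI allI impI ballI)
    fix A :: "nat \<Rightarrow> 'a set" assume "\<forall>n. J (A n)"
    then obtain B N where N: "\<And>n. N n \<in> null_sets \<mu>" and B: "\<And>n m :: nat. B n m \<in> sets M \<and> inj_on s (B n m)"
      and A: "\<And>n. A n \<subseteq> (\<Union>m. B n m) \<union> over (N n)" unfolding J_def by metis
    have "(\<Union>n. A n) \<subseteq> (\<Union>k. case prod_decode k of (n, m) \<Rightarrow> B n m) \<union> over (\<Union>n. N n)"
    proof
      fix a assume "a \<in> (\<Union>n. A n)"
      then obtain n where "a \<in> A n" by auto
      then consider m where "a \<in> B n m" | "a \<in> over (N n)" using A[of n] by auto
      thus "a \<in> (\<Union>k. case prod_decode k of (n, m) \<Rightarrow> B n m) \<union> over (\<Union>n. N n)"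
      proof cases
        case 1
        thus ?thesis by (intro UnI1 UN_I[of "prod_encode (n, m)"]) auto
      qed (auto simp: over_UN)
    qed
    moreover have "(\<Union>n. N n) \<in> null_sets \<mu>" using N by auto
    ultimately show "J (\<Union>n. A n)"
      unfolding J_def using B
      by (intro exI[of _ "\<lambda>k. case prod_decode k of (n, m) \<Rightarrow> B n m"] bexI[of _ "\<Union>n. N n"])
         (auto split: prod.split)
  next
    fix N assume "N \<in> null_sets \<mu>"
    thus "J (over N)" unfolding J_def by (intro exI[of _ "\<lambda>_. {}"] bexI[of _ N]) auto
  next
    fix A B assume "J B" "A \<subseteq> B"
    thus "J A" unfolding J_def by (meson subset_trans)
  qed
  obtain D S C where "fibration_ideal \<mu> M s \<V> J D S" and C: "C \<in> S" "decides C (space M)"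
    using fibration_ideal_exists[OF J sets.top] .
  then interpret fibration_ideal \<mu> M s \<V> J D S by simp
  have split: "AE x in \<mu>. x \<in> D R \<longrightarrow> (\<exists>A\<in>\<Union>S. \<exists>B\<in>\<Union>S. A \<inter> B = {} \<and> x \<in> D (R \<inter> A) \<and> x \<in> D (R \<inter> B))"
    if R: "R \<in> sets M" for R
  proof -
    have RA: "R \<inter> A \<in> sets M" if "A \<in> \<Union>S" for A
      using R cell_sets[OF that] by (rule sets.Int)
    define I where "I = {(A, B) \<in> \<Union>S \<times> \<Union>S. A \<inter> B = {}}"
    have I: "countable I"
      by (rule countable_subset[OF _ countable_SIGMA[OF countable_cells countable_cells]]) (auto simp: I_def)
    define E where "E = (\<Union>(A, B)\<in>I. D (R \<inter> A) \<inter> D (R \<inter> B))"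
    have E [measurable]: "E \<in> sets \<mu>"
      unfolding E_def
    proof (intro sets.countable_UN''[OF I])
      fix p assume p: "p \<in> I"
      obtain A B where AB: "p = (A, B)" by (cases p)
      with p have "A \<in> \<Union>S" "B \<in> \<Union>S" unfolding I_def by simp_all
      hence "R \<inter> A \<in> sets M" "R \<inter> B \<in> sets M" using RA by simp_all
      thus "(case p of (A, B) \<Rightarrow> D (R \<inter> A) \<inter> D (R \<inter> B)) \<in> sets \<mu>"
        unfolding AB by (simp only: prod.case D_sets sets.Int)
    qed
    \<comment> \<open>Once \<open>K\<close> is removed, every cell around a remaining point is large
      over its image. Two remaining points of one fibre would then put their image into
      \<open>E\<close> through a pair of disjoint cells.\<close>
    define K where "K = (\<Union>A\<in>\<Union>S. R \<inter> A - over (D (R \<inter> A)))"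
    have JK: "J K" unfolding K_def
      by (intro sigma_ideal_UN[OF J countable_cells] D_J RA)
    have [measurable]: "K \<in> sets M"
      unfolding K_def by (intro sets.countable_UN''[OF countable_cells] sets.Diff over_sets D_sets RA)
    define P where "P = R - over E - K"
    have "P \<in> sets M" unfolding P_def using R by measurable
    moreover have "inj_on s P"
    proof (rule inj_onI, rule ccontr)
      fix a b assume ab: "a \<in> P" "b \<in> P" "s a = s b" "a \<noteq> b"
      have sp: "a \<in> space M" "b \<in> space M" using ab sets.sets_into_space[OF R] unfolding P_def by auto
      then obtain C where C: "C \<in> S" "\<forall>A\<in>C. \<forall>B\<in>C. a \<in> A \<longrightarrow> b \<in> B \<longrightarrow> A \<inter> B = {}"
        using S_separating ab(4) unfolding separating_def by meson
      obtain A B where AB: "A \<in> C" "B \<in> C" "a \<in> A" "b \<in> B" using S_cover(3)[OF C(1)] sp by metis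
      have "a \<in> over (D (R \<inter> A))" "b \<in> over (D (R \<inter> B))" using ab(1,2) AB C(1) unfolding P_def K_def by auto
      hence "s a \<in> D (R \<inter> A) \<inter> D (R \<inter> B)" using ab(3) unfolding over_def by auto
      moreover have "(A, B) \<in> I" unfolding I_def using AB C by auto
      ultimately have "s a \<in> E" unfolding E_def by auto
      with sp(1) ab(1) show False unfolding P_def over_def by auto
    qed
    ultimately have "J P" unfolding J_def by (intro exI[of _ "\<lambda>_. P"] bexI[of _ "{}"]) auto
    moreover have "R - over E \<subseteq> P \<union> K" unfolding P_def by auto
    ultimately have "J (R - over E)" using sigma_idealD(1)[OF J sigma_ideal_Un[OF J _ JK]] by blast
    from AE_D_subset[OF R E this] show ?thesis
      by eventually_elim (auto simp: E_def I_def)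
  qed
  have "AE x in \<mu>. \<forall>R\<in>pieces (space M). x \<in> D R \<longrightarrow>
      (\<exists>A\<in>\<Union>S. \<exists>B\<in>\<Union>S. A \<inter> B = {} \<and> x \<in> D (R \<inter> A) \<and> x \<in> D (R \<inter> B))"
    by (intro AE_ball_countable[THEN iffD2] ballI split countable_pieces) (rule pieces_sets[OF sets.top])
  hence "AE x in \<mu>. x \<notin> D (space M)"
    using AE_generic[OF sets.top] AE_space
  proof eventually_elim
    fix x assume x: "generic (space M) x" "x \<in> space \<mu>" and sp: "\<forall>R\<in>pieces (space M). x \<in> D R \<longrightarrow>
      (\<exists>A\<in>\<Union>S. \<exists>B\<in>\<Union>S. A \<inter> B = {} \<and> x \<in> D (R \<inter> A) \<and> x \<in> D (R \<inter> B))"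
    show "x \<notin> D (space M)"
    proof
      assume xD: "x \<in> D (space M)"
      \<comment> \<open>One family for each point of the fibre: a point that has a cell from each of
        them differs from every point of the fibre. Of two disjoint large cells at least one misses
        a given point, so a large refinement is always available.\<close>
      define \<D> where "\<D> = (\<lambda>a. {A \<in> \<Union>S. a \<notin> A}) ` {a \<in> space M. s a = x}"
      obtain a where a: "a \<in> space M" "s a = x" "\<And>C. C \<in> \<D> \<Longrightarrow> \<exists>A\<in>C. a \<in> A"
      proof (rule generic_fibre_point[OF sets.top C x xD])
        show "countable \<D>" unfolding \<D>_def using countable[OF x(2)] by auto
        show "\<Union>\<D> \<subseteq> \<Union>S" unfolding \<D>_def by auto
        fix R C assume R: "R \<in> pieces (space M)" "x \<in> D R" and C: "C \<in> \<D>"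
        obtain a where a: "C = {A \<in> \<Union>S. a \<notin> A}" using C unfolding \<D>_def by auto
        obtain A B where "A \<in> \<Union>S" "B \<in> \<Union>S" "A \<inter> B = {}" "x \<in> D (R \<inter> A)" "x \<in> D (R \<inter> B)"
          using sp R by meson
        thus "\<exists>A\<in>C. x \<in> D (R \<inter> A)" unfolding a by (cases "a \<in> A") auto
      qed auto
      from a(3)[of "{A \<in> \<Union>S. a \<notin> A}"] a(1,2) show False unfolding \<D>_def by auto
    qed
  qed
  hence "D (space M) \<in> null_sets \<mu>" using AE_iff_null_sets[OF D_sets[OF sets.top]] by simp
  hence "J (over (D (space M)))" by (rule sigma_idealD(3)[OF J])
  from sigma_ideal_Un[OF J D_J[OF sets.top] this] have "J (space M)"
    by (rule sigma_idealD(1)[OF J]) auto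
  with that show thesis unfolding J_def by blast
qed

end

context borel_fibration
begin

text \<open>The null set from \<open>image_measurable\<close> depends on the Borel set. Collecting
  those of a countable generator gives one \<open>N\<close> for all Borel sets, since injectivity on
  \<open>B n\<close> makes taking images commute with complements.\<close>

theorem countable_borel_sections:
  assumes countable: "\<And>x. x \<in> space \<mu> \<Longrightarrow> countable {a \<in> space M. s a = x}"
  obtains B :: "nat \<Rightarrow> 'a set" and N where "\<And>n. B n \<in> sets M" "\<And>n. inj_on s (B n)"
    "N \<in> null_sets \<mu>" "space M \<subseteq> (\<Union>n. B n) \<union> over N"
    "\<And>n A. A \<in> sets M \<Longrightarrow> s ` (B n \<inter> A) - N \<in> sets \<mu>"
proof -
  obtain B :: "nat \<Rightarrow> 'a set" and N0 where B: "\<And>n. B n \<in> sets M" "\<And>n. inj_on s (B n)"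
    and N0: "N0 \<in> null_sets \<mu>" "space M \<subseteq> (\<Union>n. B n) \<union> over N0"
    using countable_sections[OF countable] by metis
  obtain \<G> where \<G>: "countable \<G>" "\<G> \<subseteq> sets M" "sets M = sigma_sets (space M) \<G>"
    using standard_borel_generator[OF standard_M] by metis
  define approx where "approx n A p \<longleftrightarrow> fst p \<in> sets \<mu> \<and> snd p \<in> null_sets \<mu> \<and>
      fst p - snd p \<subseteq> s ` (B n \<inter> A) \<and> s ` (B n \<inter> A) \<subseteq> fst p \<union> snd p" for n A p
  define D where "D n A = fst (SOME p. approx n A p)" for n A
  define Z where "Z n A = snd (SOME p. approx n A p)" for n A
  have "approx n A (SOME p. approx n A p)" if A: "A \<in> sets M" for n A
  proof -
    obtain D' N' where "D' \<in> sets \<mu>" "N' \<in> null_sets \<mu>" "D' - N' \<subseteq> s ` (B n \<inter> A)"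
        "s ` (B n \<inter> A) \<subseteq> D' \<union> N'"
      by (rule image_measurable[OF sets.Int[OF B(1)[of n] A]])
    hence "approx n A (D', N')" unfolding approx_def by simp
    thus ?thesis by (rule someI)
  qed
  hence D: "\<And>n A. A \<in> sets M \<Longrightarrow> D n A \<in> sets \<mu>"
    and Z: "\<And>n A. A \<in> sets M \<Longrightarrow> Z n A \<in> null_sets \<mu>"
    and DZ: "\<And>n A. A \<in> sets M \<Longrightarrow> D n A - Z n A \<subseteq> s ` (B n \<inter> A)"
      "\<And>n A. A \<in> sets M \<Longrightarrow> s ` (B n \<inter> A) \<subseteq> D n A \<union> Z n A"
    unfolding approx_def D_def Z_def by auto
  \<comment> \<open>The whole space is added because the complement step starts from the image of
    all of \<open>B n\<close>.\<close>
  define \<G>' where "\<G>' = insert (space M) \<G>"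
  have \<G>': "countable \<G>'" "A \<in> \<G>' \<Longrightarrow> A \<in> sets M" for A using \<G> unfolding \<G>'_def by auto
  define N where "N = N0 \<union> (\<Union>n. \<Union>A\<in>\<G>'. Z n A)"
  have N: "N \<in> null_sets \<mu>"
    unfolding N_def using N0(1) Z \<G>' by (intro null_sets.Un null_sets_UN null_sets_UN') auto
  have *: "s ` (B n \<inter> A) - N \<in> sets \<mu>" if A: "A \<in> \<G>'" for n A
  proof -
    have "Z n A \<subseteq> N" using A unfolding N_def by auto
    hence "s ` (B n \<inter> A) - N = D n A - N" using DZ[OF \<G>'(2)[OF A], of n] by auto
    with D[OF \<G>'(2)[OF A]] N show ?thesis by auto
  qed
  have top: "s ` B n - N \<in> sets \<mu>" for n
    using *[of "space M" n] sets.sets_into_space[OF B(1)[of n]] unfolding \<G>'_def by (simp add: Int_absorb2)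
  have "s ` (B n \<inter> A) - N \<in> sets \<mu>" if "A \<in> sets M" for n A
    using that[unfolded \<G>(3)]
  proof induction
    case (Basic A)
    thus ?case using * \<G>'_def by auto
  next
    case (Compl A)
    have "s ` (B n \<inter> (space M - A)) = s ` B n - s ` (B n \<inter> A)"
      using B(2)[of n] sets.sets_into_space[OF B(1)[of n]] by (auto simp: inj_on_def)
    hence "s ` (B n \<inter> (space M - A)) - N = (s ` B n - N) - (s ` (B n \<inter> A) - N)" by auto
    with top Compl.IH show ?case by auto
  next
    case (Union A)
    have "s ` (B n \<inter> (\<Union>i. A i)) - N = (\<Union>i. s ` (B n \<inter> A i) - N)" by auto
    moreover have "(\<Union>i. s ` (B n \<inter> A i) - N) \<in> sets \<mu>"
      using Union.IH by (intro sets.countable_nat_UN) blast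
    ultimately show ?case by (simp only:)
  qed auto
  moreover have "space M \<subseteq> (\<Union>n. B n) \<union> over N" using N0(2) unfolding N_def over_def by auto
  ultimately show thesis using that B N by metis
qed

end

section \<open>Positive definite kernels on forests\<close>

definition gdist :: "('v \<times> 'v) set \<Rightarrow> 'v \<Rightarrow> 'v \<Rightarrow> nat" where
  "gdist E u v = (LEAST n. (u, v) \<in> E ^^ n)"

definition dist_kernel :: "('v \<times> 'v) set \<Rightarrow> real \<Rightarrow> 'v \<Rightarrow> 'v \<Rightarrow> real" where
  "dist_kernel E t u v = (if (u, v) \<in> E\<^sup>* then t ^ gdist E u v else 0)"

lemma rtrancl_distinct_path:
  assumes "(a, b) \<in> R\<^sup>*"
  obtains xs where "xs \<noteq> []" "hd xs = a" "last xs = b" "distinct xs" "successively (\<lambda>x y. (x, y) \<in> R) xs"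
  using assms
proof (induction arbitrary: thesis rule: converse_rtrancl_induct)
  case base
  show ?case by (rule base[of "[b]"]) auto
next
  case (step y z)
  obtain xs where xs: "xs \<noteq> []" "hd xs = z" "last xs = b" "distinct xs"
      "successively (\<lambda>x y. (x, y) \<in> R) xs"
    using step.IH .
  show ?case
  proof (cases "y \<in> set xs")
    case True
    then obtain ys zs where "xs = ys @ y # zs" by (meson split_list)
    with xs show ?thesis by (intro step.prems[of "y # zs"]) (auto simp: successively_append_iff)
  next
    case False
    with xs step.hyps(1) show ?thesis
      by (intro step.prems[of "y # xs"]) (auto simp: successively_Cons)
  qed
qed

locale forest =
  fixes E :: "('v \<times> 'v) set"
  assumes sym_E: "sym E"
    and no_cycle: "length vs \<ge> 3 \<Longrightarrow> distinct vs \<Longrightarrow> successively (\<lambda>x y. (x, y) \<in> E) vs \<Longrightarrow>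
      (last vs, hd vs) \<notin> E"
begin

lemma E_sym: "(u, v) \<in> E \<Longrightarrow> (v, u) \<in> E"
  using sym_E by (rule symD)

lemma E_rtrancl_sym: "(u, v) \<in> E\<^sup>* \<Longrightarrow> (v, u) \<in> E\<^sup>*"
  using sym_rtrancl[OF sym_E] by (rule symD)

lemma relpow_sym: "(u, v) \<in> E ^^ n \<Longrightarrow> (v, u) \<in> E ^^ n"
proof (induction n arbitrary: v)
  case (Suc n)
  then obtain w where "(u, w) \<in> E ^^ n" "(w, v) \<in> E" by auto
  with Suc.IH E_sym show ?case by (blast intro: relpow_Suc_I2)
qed auto

lemma gdist_sym: "gdist E u v = gdist E v u"
  unfolding gdist_def using relpow_sym by metis

lemma gdist_relpow: "(u, v) \<in> E\<^sup>* \<Longrightarrow> (u, v) \<in> E ^^ gdist E u v"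
  unfolding gdist_def by (meson LeastI rtrancl_imp_relpow)

lemma gdist_le: "(u, v) \<in> E ^^ n \<Longrightarrow> gdist E u v \<le> n"
  unfolding gdist_def by (rule Least_le)

lemma gdist_self [simp]: "gdist E u u = 0"
  using gdist_le[of u u 0] by simp

lemma gdist_eq_0: "(u, v) \<in> E\<^sup>* \<Longrightarrow> gdist E u v = 0 \<Longrightarrow> u = v"
  using gdist_relpow[of u v] by simp

lemma dist_kernel_sym: "dist_kernel E t u v = dist_kernel E t v u"
  unfolding dist_kernel_def using E_rtrancl_sym gdist_sym[of u v] by auto

definition avoiding :: "'v \<Rightarrow> ('v \<times> 'v) set" where
  "avoiding v = {(a, b) \<in> E. a \<noteq> v \<and> b \<noteq> v}"

lemma avoiding_sym: "(a, b) \<in> (avoiding v)\<^sup>* \<Longrightarrow> (b, a) \<in> (avoiding v)\<^sup>*"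
proof -
  have "sym (avoiding v)" unfolding avoiding_def by (intro symI) (auto dest: E_sym)
  thus "(a, b) \<in> (avoiding v)\<^sup>* \<Longrightarrow> (b, a) \<in> (avoiding v)\<^sup>*" using sym_rtrancl by (meson symD)
qed

text \<open>A path from \<open>w\<close> to \<open>p\<close> that avoids \<open>v\<close> closes up
  through \<open>v\<close> to a cycle; \<open>w \<noteq> p\<close> makes this cycle long
  enough.\<close>

lemma neighbours_connected_avoiding:
  assumes "(w, v) \<in> E" "(p, v) \<in> E" "(w, p) \<in> (avoiding v)\<^sup>*"
  shows "w = p"
proof (rule ccontr)
  assume "w \<noteq> p"
  obtain xs where xs: "xs \<noteq> []" "hd xs = w" "last xs = p" "distinct xs"
      "successively (\<lambda>x y. (x, y) \<in> avoiding v) xs"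
    using rtrancl_distinct_path[OF assms(3)] .
  have len: "length xs \<ge> 2" using xs(1-3) \<open>w \<noteq> p\<close> by (cases xs rule: list.exhaust; cases "tl xs") auto
  have "v \<notin> set xs"
    using xs(5) len
  proof (induction xs rule: induct_list012)
    case (3 x y zs)
    thus ?case by (cases zs) (auto simp: avoiding_def)
  qed auto
  moreover have "successively (\<lambda>x y. (x, y) \<in> E) xs"
    using xs(5) by (rule successively_mono) (auto simp: avoiding_def)
  ultimately have "(last (v # xs), hd (v # xs)) \<notin> E"
    using len xs assms(1) by (intro no_cycle) (auto simp: successively_Cons E_sym)
  with xs(1,3) assms(2) show False by simp
qed

text \<open>The choice depends only on the set of vertices reachable from \<open>u\<close>, which is
  the same throughout a component; so there is one base vertex for each component.\<close>

definition root :: "'v \<Rightarrow> 'v" where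
  "root u = (SOME w. (u, w) \<in> E\<^sup>*)"

definition level :: "'v \<Rightarrow> nat" where
  "level u = gdist E (root u) u"

lemma root_connected: "(u, root u) \<in> E\<^sup>*" "(root u, u) \<in> E\<^sup>*"
proof -
  show "(u, root u) \<in> E\<^sup>*" unfolding root_def by (rule someI[of _ u]) simp
  thus "(root u, u) \<in> E\<^sup>*" by (rule E_rtrancl_sym)
qed

lemma root_eq:
  assumes "(u, v) \<in> E\<^sup>*"
  shows "root u = root v"
proof -
  have "(u, w) \<in> E\<^sup>* \<longleftrightarrow> (v, w) \<in> E\<^sup>*" for w
    using assms E_rtrancl_sym[OF assms] rtrancl_trans by meson
  thus ?thesis unfolding root_def by simp
qed

lemma parent_exists:
  assumes "level v = Suc m"
  obtains p where "(p, v) \<in> E" "level p = m"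
proof -
  have "(root v, v) \<in> E ^^ Suc m"
    using gdist_relpow[OF root_connected(2)[of v]] assms unfolding level_def by simp
  then obtain p where p: "(root v, p) \<in> E ^^ m" "(p, v) \<in> E" by auto
  have [simp]: "root p = root v" using p(2) by (intro root_eq) auto
  have "level p \<le> m" unfolding level_def using gdist_le[OF p(1)] by simp
  moreover have "m \<le> level p"
  proof -
    have "(root v, p) \<in> E ^^ level p"
      using gdist_relpow[OF root_connected(2)[of p]] unfolding level_def by simp
    with p(2) have "(root v, v) \<in> E ^^ Suc (level p)" by auto
    from gdist_le[OF this] assms show ?thesis unfolding level_def by simp
  qed
  ultimately show thesis using that p(2) by simp
qed

lemma level_0: "level v = 0 \<Longrightarrow> root v = v"
  unfolding level_def by (intro gdist_eq_0 root_connected)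

text \<open>Going from parent to parent, the level drops below \<open>level v\<close> after the
  first step, so the path cannot run into \<open>v\<close>.\<close>

lemma root_path_avoiding:
  "a \<noteq> v \<Longrightarrow> level a \<le> level v \<Longrightarrow> (a, root a) \<in> (avoiding v)\<^sup>*"
proof (induction "level a" arbitrary: a)
  case 0
  thus ?case using level_0[of a] by simp
next
  case (Suc m)
  obtain p where p: "(p, a) \<in> E" "level p = m" using parent_exists[of a m] Suc.hyps(2) by metis
  have "p \<noteq> v" using p(2) Suc.hyps(2) Suc.prems(2) by auto
  moreover have "root p = root a" using p(1) by (intro root_eq) auto
  ultimately have "(p, root a) \<in> (avoiding v)\<^sup>*" using Suc.hyps(1)[of p] p(2) Suc.hyps(2) Suc.prems(2) by auto
  moreover have "(a, p) \<in> avoiding v"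
    using p(1) \<open>p \<noteq> v\<close> Suc.prems(1) E_sym unfolding avoiding_def by auto
  ultimately show ?case by (rule converse_rtrancl_into_rtrancl[rotated])
qed

lemma relpow_avoiding:
  "(a, w) \<in> E ^^ k \<Longrightarrow> (\<And>j. j \<le> k \<Longrightarrow> (a, v) \<notin> E ^^ j) \<Longrightarrow> (a, w) \<in> (avoiding v)\<^sup>*"
proof (induction k arbitrary: w)
  case (Suc k)
  then obtain y where y: "(a, y) \<in> E ^^ k" "(y, w) \<in> E" by auto
  have "y \<noteq> v" using Suc.prems(2)[of k] y(1) by auto
  moreover have "w \<noteq> v" using Suc.prems(2)[of "Suc k"] Suc.prems(1) by auto
  ultimately have "(y, w) \<in> avoiding v" using y(2) unfolding avoiding_def by auto
  moreover have "(a, y) \<in> (avoiding v)\<^sup>*" using Suc.IH[OF y(1)] Suc.prems(2) by auto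
  ultimately show ?case by auto
qed auto

text \<open>The last vertex of a geodesic from \<open>u\<close> to \<open>v\<close> before \<open>v\<close> is joined to the parent \<open>p\<close> through
  \<open>u\<close> and the root without meeting \<open>v\<close>; as there is no cycle it is equal to \<open>p\<close>.\<close>

lemma gdist_parent:
  assumes v: "level v = Suc m" and p: "(p, v) \<in> E" "level p = m"
    and u: "u \<noteq> v" "level u \<le> level v" "(u, v) \<in> E\<^sup>*"
  shows "gdist E u v = Suc (gdist E u p)"
proof -
  have "gdist E u v \<noteq> 0" using gdist_eq_0[OF u(3)] u(1) by auto
  then obtain k where k: "gdist E u v = Suc k" using not0_implies_Suc by auto
  with gdist_relpow[OF u(3)] obtain w where w: "(u, w) \<in> E ^^ k" "(w, v) \<in> E" by auto
  have "(u, w) \<in> (avoiding v)\<^sup>*"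
  proof (rule relpow_avoiding[OF w(1)])
    show "(u, v) \<notin> E ^^ j" if "j \<le> k" for j using gdist_le[of u v j] that k by auto
  qed
  moreover have "(u, p) \<in> (avoiding v)\<^sup>*"
  proof -
    have "(p, v) \<in> E\<^sup>*" using p(1) by auto
    hence "root p = root u" using root_eq root_eq[OF u(3)] by simp
    moreover have "p \<noteq> v" using v p(2) by auto
    ultimately have "(p, root u) \<in> (avoiding v)\<^sup>*" using root_path_avoiding[of p v] v p(2) by simp
    with root_path_avoiding[OF u(1,2)] show ?thesis by (meson avoiding_sym rtrancl_trans)
  qed
  ultimately have "(w, p) \<in> (avoiding v)\<^sup>*" by (meson avoiding_sym rtrancl_trans)
  hence "w = p" using neighbours_connected_avoiding[OF w(2) p(1)] by simp
  with gdist_le[OF w(1)] have "gdist E u p \<le> k" by simp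
  moreover have "gdist E u v \<le> Suc (gdist E u p)"
  proof -
    have "(u, p) \<in> E\<^sup>*" using w(1) \<open>w = p\<close> relpow_imp_rtrancl by auto
    with gdist_relpow p(1) show ?thesis by (intro gdist_le) auto
  qed
  ultimately show ?thesis using k by simp
qed

lemma dist_kernel_parent:
  assumes "level v = Suc m" "(p, v) \<in> E" "level p = m" "u \<noteq> v" "level u \<le> level v"
  shows "dist_kernel E t u v = t * dist_kernel E t u p"
proof -
  have "(u, v) \<in> E\<^sup>* \<longleftrightarrow> (u, p) \<in> E\<^sup>*"
    using assms(2) E_sym[OF assms(2)] rtrancl_into_rtrancl by meson
  thus ?thesis using gdist_parent[OF assms(1-5)] unfolding dist_kernel_def by simp
qed

lemma dist_kernel_self [simp]: "dist_kernel E t u u = 1"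
  unfolding dist_kernel_def by simp

lemma nonneg_Reals_sum: "(\<And>i. i \<in> I \<Longrightarrow> f i \<in> \<real>\<^sub>\<ge>\<^sub>0) \<Longrightarrow> sum f I \<in> \<real>\<^sub>\<ge>\<^sub>0"
  by (induction I rule: infinite_finite_induct) auto

lemma sum_indicator_pos:
  fixes c :: "'i \<Rightarrow> complex" and g :: "'i \<Rightarrow> 'w"
  assumes "finite I"
  shows "(\<Sum>i\<in>I. \<Sum>j\<in>I. cnj (c i) * (if g i = w \<and> g j = w then 1 else 0) * c j) \<in> \<real>\<^sub>\<ge>\<^sub>0"
proof -
  define z where "z = (\<Sum>j\<in>I. if g j = w then c j else 0)"
  have "(\<Sum>i\<in>I. \<Sum>j\<in>I. cnj (c i) * (if g i = w \<and> g j = w then 1 else 0) * c j) =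
        (\<Sum>i\<in>I. \<Sum>j\<in>I. cnj (if g i = w then c i else 0) * (if g j = w then c j else 0))"
    by (intro sum.cong) auto
  also have "\<dots> = cnj z * z" unfolding z_def by (simp add: sum_product cnj_sum)
  also have "\<dots> = of_real ((cmod z)\<^sup>2)" using complex_norm_square[of z] by (simp add: mult.commute)
  also have "\<dots> \<in> \<real>\<^sub>\<ge>\<^sub>0" by (simp only: nonneg_Reals_of_real_iff) simp
  finally show ?thesis .
qed

text \<open>Moving the vertices of maximal level to their parent changes the quadratic form by
  \<open>1 - t\<^sup>2\<close> times a square, since the kernel gains a factor \<open>t\<close> on each step to the parent.\<close>

theorem dist_kernel_pos:
  fixes c :: "'i \<Rightarrow> complex" and g :: "'i \<Rightarrow> 'v"
  assumes t: "0 \<le> t" "t \<le> 1" and I: "finite I"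
  shows "(\<Sum>i\<in>I. \<Sum>j\<in>I. cnj (c i) * of_real (dist_kernel E t (g i) (g j)) * c j) \<in> \<real>\<^sub>\<ge>\<^sub>0"
proof (induction "\<Sum>i\<in>I. level (g i)" arbitrary: c g rule: less_induct)
  case less
  show ?case
  proof (cases "\<forall>i\<in>I. level (g i) = 0")
    case True
    \<comment> \<open>All vertices are roots here, and different roots lie in different components.
      The kernel is thus the sum of the indicator kernels of single vertices.\<close>
    have K: "complex_of_real (dist_kernel E t (g i) (g j)) =
        (\<Sum>w\<in>g ` I. if g i = w \<and> g j = w then 1 else 0)" if ij: "i \<in> I" "j \<in> I" for i j
    proof (cases "g i = g j")
      case True
      have "(\<Sum>w\<in>g ` I. if g j = w \<and> g j = w then 1 else 0 :: complex) = 1"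
        using ij I by (simp add: sum.delta)
      with True show ?thesis by simp
    next
      case False
      hence "(g i, g j) \<notin> E\<^sup>*"
        using root_eq[of "g i" "g j"] level_0 \<open>\<forall>i\<in>I. level (g i) = 0\<close> ij by auto
      with False show ?thesis unfolding dist_kernel_def by (auto intro!: sum.neutral)
    qed
    have "(\<Sum>i\<in>I. \<Sum>j\<in>I. cnj (c i) * of_real (dist_kernel E t (g i) (g j)) * c j) =
        (\<Sum>i\<in>I. \<Sum>j\<in>I. \<Sum>w\<in>g ` I. cnj (c i) * (if g i = w \<and> g j = w then 1 else 0) * c j)"
      by (intro sum.cong refl) (simp only: K sum_distrib_left sum_distrib_right)
    also have "\<dots> = (\<Sum>i\<in>I. \<Sum>w\<in>g ` I. \<Sum>j\<in>I. cnj (c i) * (if g i = w \<and> g j = w then 1 else 0) * c j)"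
      by (intro sum.cong refl) (rule sum.swap)
    also have "\<dots> = (\<Sum>w\<in>g ` I. \<Sum>i\<in>I. \<Sum>j\<in>I. cnj (c i) * (if g i = w \<and> g j = w then 1 else 0) * c j)"
      by (rule sum.swap)
    also have "\<dots> \<in> \<real>\<^sub>\<ge>\<^sub>0" by (intro nonneg_Reals_sum sum_indicator_pos I)
    finally show ?thesis .
  next
    case False
    define M where "M = Max ((\<lambda>i. level (g i)) ` I)"
    have M: "level (g i) \<le> M" if "i \<in> I" for i unfolding M_def using that I by auto
    have "M \<in> (\<lambda>i. level (g i)) ` I" unfolding M_def using False I by (intro Max_in) auto
    then obtain i0 where i0: "i0 \<in> I" "level (g i0) = M" by auto
    define v where "v = g i0"
    from False M have "M \<noteq> 0" by fastforce
    then obtain m where m: "level v = Suc m" unfolding v_def using i0(2) not0_implies_Suc by auto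
    obtain p where p: "(p, v) \<in> E" "level p = m" using parent_exists[OF m] .
    \<comment> \<open>All occurrences of \<open>v\<close> are moved at once and their coefficients
      gain the factor \<open>t\<close>. Terms with exactly one index at \<open>v\<close> are
      reproduced by \<open>par\<close>; terms with both at \<open>v\<close> shrink from 1 to
      \<open>t\<^sup>2\<close>, which accounts for the correction.\<close>
    define g' where "g' i = (if g i = v then p else g i)" for i
    define c' where "c' i = (if g i = v then of_real t * c i else c i)" for i
    have par: "dist_kernel E t (g i) v = t * dist_kernel E t (g i) p" if "i \<in> I" "g i \<noteq> v" for i
      using dist_kernel_parent[OF m p that(2)] M[OF that(1)] i0(2) v_def by simp
    have "(\<Sum>i\<in>I. \<Sum>j\<in>I. cnj (c i) * of_real (dist_kernel E t (g i) (g j)) * c j) =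
       (\<Sum>i\<in>I. \<Sum>j\<in>I. cnj (c' i) * of_real (dist_kernel E t (g' i) (g' j)) * c' j +
          of_real (1 - t\<^sup>2) * (cnj (c i) * (if g i = v \<and> g j = v then 1 else 0) * c j))"
    proof (intro sum.cong refl)
      fix i j assume ij: "i \<in> I" "j \<in> I"
      show "cnj (c i) * of_real (dist_kernel E t (g i) (g j)) * c j =
         cnj (c' i) * of_real (dist_kernel E t (g' i) (g' j)) * c' j +
          of_real (1 - t\<^sup>2) * (cnj (c i) * (if g i = v \<and> g j = v then 1 else 0) * c j)"
        using par[OF ij(1)] par[OF ij(2)] dist_kernel_sym[of t v "g j"] dist_kernel_sym[of t p "g j"]
        unfolding g'_def c'_def
        by (cases "g i = v"; cases "g j = v") (simp_all add: algebra_simps power2_eq_square)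
    qed
    also have "\<dots> = (\<Sum>i\<in>I. \<Sum>j\<in>I. cnj (c' i) * of_real (dist_kernel E t (g' i) (g' j)) * c' j) +
       of_real (1 - t\<^sup>2) * (\<Sum>i\<in>I. \<Sum>j\<in>I. cnj (c i) * (if g i = v \<and> g j = v then 1 else 0) * c j)"
      by (simp only: sum.distrib sum_distrib_left)
    also have "\<dots> \<in> \<real>\<^sub>\<ge>\<^sub>0"
    proof (intro nonneg_Reals_add_I nonneg_Reals_mult_I sum_indicator_pos I less.hyps)
      have "(\<Sum>i\<in>I. level (g' i)) < (\<Sum>i\<in>I. level (g i))"
      proof (rule sum_strict_mono_ex1[OF I])
        show "\<forall>i\<in>I. level (g' i) \<le> level (g i)" unfolding g'_def using m p(2) by auto
        show "\<exists>i\<in>I. level (g' i) < level (g i)" using i0(1) m p(2) unfolding g'_def v_def by (intro bexI[of _ i0]) auto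
      qed
      thus "(\<Sum>i\<in>I. level (g' i)) < (\<Sum>i\<in>I. level (g i))" .
      show "complex_of_real (1 - t\<^sup>2) \<in> \<real>\<^sub>\<ge>\<^sub>0"
        using power_le_one[OF t, of 2] by (simp only: nonneg_Reals_of_real_iff)
    qed
    finally show ?thesis .
  qed
qed

end

section \<open>Cayley graphs of groupoids\<close>

context groupoid
begin

lemma composable_iff: "(a, b) \<in> composable G \<longleftrightarrow> a \<in> carr G \<and> b \<in> carr G \<and> src G a = rng G b"
  unfolding composable_def by auto

lemma unit_carr: "x \<in> units G \<Longrightarrow> x \<in> carr G"
  using units_subset by auto

lemma inv_inv:
  assumes a: "a \<in> carr G"
  shows "ginv G (ginv G a) = a"
proof -
  let ?b = "ginv G a" and ?c = "ginv G (ginv G a)"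
  have bc: "?b \<in> carr G" "?c \<in> carr G" using a inv_in by auto
  have "?c = gmult G ?c (gmult G ?b a)"
    using mult_src_right[OF bc(2)] src_inv[OF bc(1)] rng_inv[OF a] inv_mult[OF a] by simp
  also have "\<dots> = gmult G (gmult G ?c ?b) a"
    using bc a by (intro mult_assoc[symmetric]) (simp_all add: composable_iff src_inv rng_inv)
  also have "\<dots> = a"
    using inv_mult[OF bc(1)] src_inv[OF a] rng_mult_left[OF a] by simp
  finally show ?thesis .
qed

lemma quotient_props:
  assumes "a \<in> carr G" "b \<in> carr G" "rng G a = rng G b"
  shows "gmult G (ginv G a) b \<in> carr G"
    and "rng G (gmult G (ginv G a) b) = src G a"
    and "src G (gmult G (ginv G a) b) = src G b"
    and "gmult G a (gmult G (ginv G a) b) = b"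
proof -
  have c: "(ginv G a, b) \<in> composable G" using assms by (simp add: composable_iff inv_in src_inv)
  show "gmult G (ginv G a) b \<in> carr G" by (rule mult_in[OF c])
  show "rng G (gmult G (ginv G a) b) = src G a" using rng_mult[OF c] rng_inv[OF assms(1)] by simp
  show "src G (gmult G (ginv G a) b) = src G b" using src_mult[OF c] by simp
  have "gmult G a (gmult G (ginv G a) b) = gmult G (gmult G a (ginv G a)) b"
    using c assms by (intro mult_assoc[symmetric]) (simp_all add: composable_iff rng_inv inv_in)
  thus "gmult G a (gmult G (ginv G a) b) = b" using assms by (simp add: mult_inv rng_mult_left)
qed

lemma quotient_mult:
  assumes "(a, b) \<in> composable G"
  shows "gmult G (ginv G a) (gmult G a b) = b"
proof -
  from assms have ab: "a \<in> carr G" "b \<in> carr G" "src G a = rng G b" by (simp_all add: composable_iff)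
  have "gmult G (ginv G a) (gmult G a b) = gmult G (gmult G (ginv G a) a) b"
    using ab by (intro mult_assoc[symmetric]) (simp_all add: composable_iff src_inv inv_in)
  thus ?thesis using ab by (simp add: inv_mult rng_mult_left)
qed

lemma quotient_compose:
  assumes "a \<in> carr G" "b \<in> carr G" "c \<in> carr G" "rng G a = rng G b" "rng G b = rng G c"
  shows "gmult G (gmult G (ginv G a) b) (gmult G (ginv G b) c) = gmult G (ginv G a) c"
proof -
  have "gmult G (gmult G (ginv G a) b) (gmult G (ginv G b) c) =
        gmult G (ginv G a) (gmult G b (gmult G (ginv G b) c))"
    using assms by (intro mult_assoc) (simp_all add: composable_iff inv_in src_inv quotient_props)
  thus ?thesis using assms by (simp add: quotient_props)
qed

lemma inv_quotient:
  assumes "a \<in> carr G" "b \<in> carr G" "rng G a = rng G b"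
  shows "ginv G (gmult G (ginv G a) b) = gmult G (ginv G b) a"
proof -
  let ?q = "gmult G (ginv G a) b" and ?q' = "gmult G (ginv G b) a"
  have q: "?q \<in> carr G" "rng G ?q = src G a" "src G ?q = src G b" using assms by (simp_all add: quotient_props)
  have q': "?q' \<in> carr G" "rng G ?q' = src G b" using assms by (simp_all add: quotient_props)
  have "gmult G ?q ?q' = gmult G (ginv G a) a" using assms by (intro quotient_compose) auto
  hence "gmult G ?q ?q' = rng G ?q" using assms q by (simp add: inv_mult)
  moreover have "?q' = gmult G (ginv G ?q) (gmult G ?q ?q')"
    using q q' by (intro quotient_mult[symmetric]) (simp add: composable_iff)
  ultimately have "?q' = gmult G (ginv G ?q) (rng G ?q)" by simp
  also have "\<dots> = ginv G ?q" using mult_src_right[OF inv_in[OF q(1)]] src_inv[OF q(1)] by simp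
  finally show ?thesis by simp
qed

lemma mult_inv_right:
  assumes "(p, q) \<in> composable G"
  shows "gmult G (gmult G p q) (ginv G q) = p"
proof -
  from assms have pq: "p \<in> carr G" "q \<in> carr G" "src G p = rng G q" by (simp_all add: composable_iff)
  have "gmult G (gmult G p q) (ginv G q) = gmult G p (gmult G q (ginv G q))"
    using pq by (intro mult_assoc) (simp_all add: composable_iff rng_inv inv_in)
  thus ?thesis using pq by (simp add: mult_inv mult_src_right[symmetric]) (metis mult_src_right)
qed

lemma div_props:
  assumes "a \<in> carr G" "q \<in> carr G" "src G a = src G q"
  shows "(a, ginv G q) \<in> composable G" "(gmult G a (ginv G q), q) \<in> composable G"
    "gmult G (gmult G a (ginv G q)) q = a"
proof -
  show c: "(a, ginv G q) \<in> composable G" using assms by (simp add: composable_iff inv_in rng_inv)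
  show c': "(gmult G a (ginv G q), q) \<in> composable G"
    using assms mult_in[OF c] src_mult[OF c] by (simp add: composable_iff src_inv)
  have "gmult G (gmult G a (ginv G q)) q = gmult G a (gmult G (ginv G q) q)"
    using c assms by (intro mult_assoc) (simp_all add: composable_iff src_inv inv_in)
  thus "gmult G (gmult G a (ginv G q)) q = a"
    using assms mult_src_right[OF assms(1)] by (simp add: inv_mult)
qed

lemma set_power_mono: "Q \<subseteq> Q' \<Longrightarrow> set_power G Q k \<subseteq> set_power G Q' k"
proof (induction k)
  case (Suc k)
  thus ?case by (auto simp: set_mult_def)
qed simp

definition cayley :: "'g set \<Rightarrow> 'g \<Rightarrow> ('g \<times> 'g) set" where
  "cayley Q x = edge_rel (rfibre G x) (\<lambda>a b. gmult G (ginv G a) b \<in> Q)"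

lemma cayley_iff:
  "(a, b) \<in> cayley Q x \<longleftrightarrow> a \<in> carr G \<and> b \<in> carr G \<and> rng G a = x \<and> rng G b = x \<and> gmult G (ginv G a) b \<in> Q"
  unfolding cayley_def edge_rel_def rfibre_def by auto

text \<open>Telescoping: the quotients along a path multiply to the quotient of its ends, and a
  factorization of this quotient lifts to the path of partial products from \<open>a\<close>. Hence
  the distance in every fibre comes from a function on \<open>G\<close>.\<close>

lemma cayley_relpow:
  assumes Q: "Q \<subseteq> carr G" and a: "a \<in> carr G" "rng G a = x"
  shows "b \<in> carr G \<Longrightarrow> rng G b = x \<Longrightarrow>
    (a, b) \<in> cayley Q x ^^ k \<longleftrightarrow> gmult G (ginv G a) b \<in> set_power G Q k"
proof (induction k arbitrary: b)
  case 0
  show ?case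
  proof
    assume "(a, b) \<in> cayley Q x ^^ 0"
    thus "gmult G (ginv G a) b \<in> set_power G Q 0" using a inv_mult src_in by auto
  next
    assume "gmult G (ginv G a) b \<in> set_power G Q 0"
    hence "gmult G (ginv G a) b \<in> units G" by simp
    hence "gmult G (ginv G a) b = src G a"
      using rng_unit[of "gmult G (ginv G a) b"] quotient_props(2)[of a b] a 0 by simp
    hence "b = a" using quotient_props(4)[of a b] a 0 mult_src_right by simp
    thus "(a, b) \<in> cayley Q x ^^ 0" by simp
  qed
next
  case (Suc k)
  show ?case
  proof
    assume "(a, b) \<in> cayley Q x ^^ Suc k"
    then obtain c where c: "(a, c) \<in> cayley Q x ^^ k" "(c, b) \<in> cayley Q x" by auto
    hence c': "c \<in> carr G" "rng G c = x" "gmult G (ginv G c) b \<in> Q" by (simp_all add: cayley_iff)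
    have "gmult G (ginv G a) c \<in> set_power G Q k" using Suc.IH[OF c'(1,2)] c(1) by simp
    moreover have "(gmult G (ginv G a) c, gmult G (ginv G c) b) \<in> composable G"
      using a c' Suc.prems by (simp add: composable_iff quotient_props)
    moreover have "gmult G (ginv G a) b = gmult G (gmult G (ginv G a) c) (gmult G (ginv G c) b)"
      using a c' Suc.prems by (intro quotient_compose[symmetric]) auto
    ultimately show "gmult G (ginv G a) b \<in> set_power G Q (Suc k)"
      using c'(3) by (auto simp: set_mult_def)
  next
    assume "gmult G (ginv G a) b \<in> set_power G Q (Suc k)"
    then obtain p q where pq: "gmult G (ginv G a) b = gmult G p q" "p \<in> set_power G Q k" "q \<in> Q"
      "(p, q) \<in> composable G" by (auto simp: set_mult_def)
    have pq': "p \<in> carr G" "q \<in> carr G" "src G p = rng G q" using pq(4) by (simp_all add: composable_iff)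
    have "rng G p = src G a"
      using rng_mult[OF pq(4)] pq(1) quotient_props(2)[of a b] a Suc.prems by simp
    hence ap: "(a, p) \<in> composable G" using a pq' by (simp add: composable_iff)
    define c where "c = gmult G a p"
    have c: "c \<in> carr G" "rng G c = x" "src G c = rng G q"
      using mult_in[OF ap] rng_mult[OF ap] src_mult[OF ap] a pq' unfolding c_def by simp_all
    have cq: "(c, q) \<in> composable G" using c pq' by (simp add: composable_iff)
    have "gmult G (ginv G a) c = p" unfolding c_def by (rule quotient_mult[OF ap])
    hence "(a, c) \<in> cayley Q x ^^ k" using Suc.IH[OF c(1,2)] pq(2) by simp
    moreover have "b = gmult G c q"
    proof -
      have "b = gmult G a (gmult G p q)" using quotient_props(4)[of a b] a Suc.prems pq(1) by simp
      also have "\<dots> = gmult G c q" unfolding c_def using ap pq(4) by (rule mult_assoc[symmetric])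
      finally show ?thesis .
    qed
    hence "gmult G (ginv G c) b = q" using quotient_mult[OF cq] by simp
    hence "(c, b) \<in> cayley Q x" using c Suc.prems pq(3) by (simp add: cayley_iff)
    ultimately show "(a, b) \<in> cayley Q x ^^ Suc k" by auto
  qed
qed

text \<open>The exponent is the word length of \<open>a\<close> with respect to \<open>Q\<close>;
  elements that are not words in \<open>Q\<close> get the value 0, like pairs of vertices in
  different components of the Cayley graph.\<close>

definition length_exp :: "'g set \<Rightarrow> real \<Rightarrow> 'g \<Rightarrow> real" where
  "length_exp Q t a = (if \<exists>k. a \<in> set_power G Q k then t ^ (LEAST k. a \<in> set_power G Q k) else 0)"

lemma length_exp_kernel:
  assumes Q: "Q \<subseteq> carr G" and ab: "a \<in> rfibre G x" "b \<in> rfibre G x"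
  shows "length_exp Q t (gmult G (ginv G a) b) = dist_kernel (cayley Q x) t a b"
proof -
  have "(a, b) \<in> cayley Q x ^^ k \<longleftrightarrow> gmult G (ginv G a) b \<in> set_power G Q k" for k
    using ab by (intro cayley_relpow[OF Q]) (auto simp: rfibre_def)
  thus ?thesis unfolding length_exp_def dist_kernel_def gdist_def rtrancl_power by simp
qed

lemma length_exp_unit:
  assumes "x \<in> units G"
  shows "length_exp Q t x = 1"
proof -
  have 0: "x \<in> set_power G Q 0" using assms by simp
  hence "(LEAST k. x \<in> set_power G Q k) = 0" by (intro Least_eq_0)
  with 0 show ?thesis unfolding length_exp_def by (metis power_0)
qed

text \<open>Edges of the Cayley graph have their ends over \<open>U\<close>, so that a cycle in a fibre of \<open>G\<close>
  is one in a fibre of the reduction.\<close>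

lemma cayley_forest:
  assumes U: "U \<subseteq> units G" and Q: "treeing (reduction G U) Q"
    and Q': "Q' \<subseteq> Q" "ginv G ` Q' \<subseteq> Q'" and x: "x \<in> U"
  shows "forest (cayley Q' x)"
proof
  have carr_red: "carr (reduction G U) \<subseteq> {a \<in> carr G. rng G a \<in> U \<and> src G a \<in> U}"
    unfolding carr_def reduction_def by (auto simp: space_restrict_space)
  have Q_carr: "Q \<subseteq> {a \<in> carr G. rng G a \<in> U \<and> src G a \<in> U}"
    using Q carr_red sets.sets_into_space[of Q "bspace (reduction G U)"]
    unfolding treeing_def graphing_def carr_def by auto
  show "sym (cayley Q' x)"
  proof (rule symI)
    fix a b assume ab: "(a, b) \<in> cayley Q' x"
    hence "ginv G (gmult G (ginv G a) b) \<in> Q'" using Q'(2) by (auto simp: cayley_iff)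
    with ab show "(b, a) \<in> cayley Q' x" by (simp add: cayley_iff inv_quotient)
  qed
  fix vs assume vs: "length vs \<ge> 3" "distinct vs" "successively (\<lambda>a b. (a, b) \<in> cayley Q' x) vs"
  have edge: "a \<in> rfibre (reduction G U) x" "gmult G (ginv G a) b \<in> Q" if "(a, b) \<in> cayley Q' x" for a b
  proof -
    from that have ab: "a \<in> carr G" "b \<in> carr G" "rng G a = x" "rng G b = x" "gmult G (ginv G a) b \<in> Q"
      using Q'(1) by (auto simp: cayley_iff)
    hence "rng G (gmult G (ginv G a) b) \<in> U" using Q_carr by auto
    with ab quotient_props(2)[of a b] have "src G a \<in> U" by simp
    with ab x show "a \<in> rfibre (reduction G U) x"
      unfolding rfibre_def carr_def reduction_def by (simp add: space_restrict_space)
    show "gmult G (ginv G a) b \<in> Q" by fact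
  qed
  show "(last vs, hd vs) \<notin> cayley Q' x"
  proof
    assume l: "(last vs, hd vs) \<in> cayley Q' x"
    have suc: "(vs ! i, vs ! Suc i) \<in> cayley Q' x" if "Suc i < length vs" for i
      using vs(3) that by (simp add: successively_conv_nth)
    have "set vs \<subseteq> rfibre (reduction G U) x"
    proof
      fix v assume "v \<in> set vs"
      then obtain i where i: "i < length vs" "v = vs ! i" by (metis in_set_conv_nth)
      show "v \<in> rfibre (reduction G U) x"
      proof (cases "Suc i < length vs")
        case True
        thus ?thesis using edge(1)[OF suc[OF True]] i by simp
      next
        case False
        \<comment> \<open>An edge places only its first end in the fibre of the reduction; for the
          last vertex this must be the closing edge.\<close>
        hence "v = last vs" using i by (metis Suc_lessI diff_Suc_1 last_conv_nth length_0_conv less_nat_zero_code)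
        thus ?thesis using edge(1)[OF l] by simp
      qed
    qed
    hence "graph_cycle (rfibre (reduction G U) x) (\<lambda>a b. gmult G (ginv G a) b \<in> Q) vs"
      unfolding graph_cycle_def using vs(1,2) edge(2)[OF l] edge(2)[OF suc] by auto
    moreover have "gmult (reduction G U) = gmult G" "ginv (reduction G U) = ginv G" "units (reduction G U) = U"
      unfolding reduction_def by simp_all
    ultimately show False using Q x unfolding treeing_def is_tree_def by auto
  qed
qed

lemma treeing_reduction:
  assumes U: "U \<subseteq> units G" and Q: "treeing (reduction G U) Q"
  shows "ginv G ` Q = Q" "Q \<subseteq> carr G"
    and "a \<in> carr G \<Longrightarrow> rng G a \<in> U \<Longrightarrow> src G a \<in> U \<Longrightarrow> \<exists>k. a \<in> set_power G Q k"
proof -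
  let ?H = "reduction G U"
  have red: "gmult ?H = gmult G" "ginv ?H = ginv G" "units ?H = U" "src ?H = src G" "rng ?H = rng G"
    unfolding reduction_def by simp_all
  have carr: "carr ?H = {a \<in> carr G. rng G a \<in> U \<and> src G a \<in> U}"
    unfolding carr_def reduction_def by (auto simp: space_restrict_space)
  from Q have g: "Q \<in> sets (bspace ?H)" "ginv G ` Q = Q" "(\<Union>n. set_power ?H Q n) = carr ?H"
    unfolding treeing_def graphing_def red by auto
  show "ginv G ` Q = Q" by fact
  show "Q \<subseteq> carr G" using sets.sets_into_space[OF g(1)] carr unfolding carr_def[of ?H, symmetric] by auto
  have "composable ?H \<subseteq> composable G" unfolding composable_def red carr by auto
  hence pow: "set_power ?H Q n \<subseteq> set_power G Q n" for n
  proof (induction n)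
    case 0
    thus ?case using U by (simp add: red)
  next
    case (Suc n)
    show ?case
    proof
      fix a assume "a \<in> set_power ?H Q (Suc n)"
      then obtain p q where "a = gmult G p q" "p \<in> set_power ?H Q n" "q \<in> Q" "(p, q) \<in> composable ?H"
        by (auto simp: set_mult_def red)
      thus "a \<in> set_power G Q (Suc n)" using Suc by (auto simp: set_mult_def)
    qed
  qed
  assume "a \<in> carr G" "rng G a \<in> U" "src G a \<in> U"
  hence "a \<in> carr ?H" using carr by simp
  with g(3) obtain k where "a \<in> set_power ?H Q k" by auto
  with pow show "\<exists>k. a \<in> set_power G Q k" by auto
qed

end

section \<open>Measured groupoids\<close>

context countable_measured_groupoid
begin

lemma space_mu: "space \<mu> = units G"
  using sets_eq_imp_space_eq[OF sets_mu] units_subset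
  unfolding unit_borel_def carr_def by (auto simp: space_restrict_space)

lemma space_bspace: "space (bspace G) = carr G"
  unfolding carr_def ..

text \<open>The units are the fixed points of the range map, and a countable separating family turns
  this equation into countably many Borel conditions.\<close>

lemma units_borel: "units G \<in> sets (bspace G)"
proof -
  obtain \<V> where V: "countable \<V>" "\<V> \<subseteq> sets (bspace G)"
    "\<And>x y. x \<in> space (bspace G) \<Longrightarrow> y \<in> space (bspace G) \<Longrightarrow> (\<And>V. V \<in> \<V> \<Longrightarrow> x \<in> V \<longleftrightarrow> y \<in> V) \<Longrightarrow> x = y"
    using standard_borel_generator[OF standard] by metis
  have "units G = {a \<in> space (bspace G). \<forall>V\<in>\<V>. a \<in> V \<longleftrightarrow> rng G a \<in> V}"
  proof (intro equalityI subsetI)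
    fix a assume a: "a \<in> {a \<in> space (bspace G). \<forall>V\<in>\<V>. a \<in> V \<longleftrightarrow> rng G a \<in> V}"
    hence "a = rng G a"
      using rng_in[of a] unit_carr by (intro V(3)) (auto simp: space_bspace)
    with a show "a \<in> units G" using rng_in[of a] by (simp add: space_bspace)
  qed (auto simp: space_bspace unit_carr rng_unit)
  also have "\<dots> = space (bspace G) - (\<Union>V\<in>\<V>. {a \<in> space (bspace G). \<not> (a \<in> V \<longleftrightarrow> rng G a \<in> V)})"
    by auto
  also have "\<dots> \<in> sets (bspace G)"
  proof (intro sets.Diff sets.top sets.countable_UN''[OF V(1)])
    fix V assume "V \<in> \<V>"
    hence [measurable]: "V \<in> sets (bspace G)" using V(2) by auto
    note [measurable] = rng_borel
    show "{a \<in> space (bspace G). \<not> (a \<in> V \<longleftrightarrow> rng G a \<in> V)} \<in> sets (bspace G)" by measurable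
  qed
  finally show ?thesis .
qed

lemma sets_mu_iff: "A \<in> sets \<mu> \<longleftrightarrow> A \<subseteq> units G \<and> A \<in> sets (bspace G)"
  unfolding sets_mu unit_borel_def
  using units_borel sets.sets_into_space[OF units_borel] by (intro sets_restrict_space_iff) (simp add: Int_absorb2)

lemma src_measurable: "src G \<in> measurable (bspace G) \<mu>"
proof -
  have "src G \<in> measurable (bspace G) (restrict_space (bspace G) (units G))"
    using src_borel src_in by (intro measurable_restrict_space2) (auto simp: space_bspace)
  thus ?thesis using measurable_cong_sets[OF refl sets_mu] unfolding unit_borel_def by blast
qed

lemma rng_measurable: "rng G \<in> measurable (bspace G) \<mu>"
proof -
  have "rng G \<in> measurable (bspace G) (restrict_space (bspace G) (units G))"
    using rng_borel rng_in by (intro measurable_restrict_space2) (auto simp: space_bspace)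
  thus ?thesis using measurable_cong_sets[OF refl sets_mu] unfolding unit_borel_def by blast
qed

lemma countable_sfibre:
  assumes "x \<in> units G"
  shows "countable {a \<in> space (bspace G). src G a = x}"
proof (rule countable_subset)
  show "countable (ginv G ` rfibre G x)" using countable_fibres[OF assms] by auto
  show "{a \<in> space (bspace G). src G a = x} \<subseteq> ginv G ` rfibre G x"
  proof
    fix a assume "a \<in> {a \<in> space (bspace G). src G a = x}"
    hence a: "a \<in> carr G" "src G a = x" by (simp_all add: space_bspace)
    show "a \<in> ginv G ` rfibre G x"
      using a inv_inv[OF a(1)] unfolding rfibre_def
      by (intro image_eqI[of _ _ "ginv G a"]) (simp_all add: inv_in rng_inv)
  qed
qed

lemma source_sections:
  obtains B :: "nat \<Rightarrow> 'g set" and N where "\<And>n. B n \<in> sets (bspace G)" "\<And>n. inj_on (src G) (B n)"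
    "N \<in> null_sets \<mu>" "\<And>a. a \<in> carr G \<Longrightarrow> src G a \<notin> N \<Longrightarrow> \<exists>n. a \<in> B n"
    "\<And>n A. A \<in> sets (bspace G) \<Longrightarrow> src G ` (B n \<inter> A) - N \<in> sets \<mu>"
proof -
  obtain \<V> where V: "countable \<V>" "\<V> \<subseteq> sets (bspace G)"
    "\<And>x y. x \<in> space (bspace G) \<Longrightarrow> y \<in> space (bspace G) \<Longrightarrow> (\<And>V. V \<in> \<V> \<Longrightarrow> x \<in> V \<longleftrightarrow> y \<in> V) \<Longrightarrow> x = y"
    using standard_borel_generator[OF standard] by metis
  interpret borel_fibration \<mu> "bspace G" "src G" "(\<lambda>V. V \<inter> units G) ` \<V>"
  proof
    show "standard_borel (bspace G)" by (rule standard)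
    show "src G \<in> measurable (bspace G) \<mu>" by (rule src_measurable)
    show "countable ((\<lambda>V. V \<inter> units G) ` \<V>)" using V(1) by auto
    show "(\<lambda>V. V \<inter> units G) ` \<V> \<subseteq> sets \<mu>" using V(2) units_borel by (auto simp: sets_mu_iff)
    fix x y assume xy: "x \<in> space \<mu>" "y \<in> space \<mu>"
      and sep: "\<And>V. V \<in> (\<lambda>V. V \<inter> units G) ` \<V> \<Longrightarrow> x \<in> V \<longleftrightarrow> y \<in> V"
    have "x \<in> units G" "y \<in> units G" using xy by (simp_all add: space_mu)
    moreover have "x \<in> V \<longleftrightarrow> y \<in> V" if "V \<in> \<V>" for V using sep[of "V \<inter> units G"] that calculation by auto
    ultimately show "x = y" using unit_carr by (intro V(3)) (simp_all add: space_bspace)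
  qed
  obtain B :: "nat \<Rightarrow> 'g set" and N where B: "\<And>n. B n \<in> sets (bspace G)" "\<And>n. inj_on (src G) (B n)"
    "N \<in> null_sets \<mu>" "space (bspace G) \<subseteq> (\<Union>n. B n) \<union> over N"
    "\<And>n A. A \<in> sets (bspace G) \<Longrightarrow> src G ` (B n \<inter> A) - N \<in> sets \<mu>"
  proof (rule countable_borel_sections)
    show "countable {a \<in> space (bspace G). src G a = x}" if "x \<in> space \<mu>" for x
      using countable_sfibre that by (simp add: space_mu)
  qed (rule that)
  have cover: "\<exists>n. a \<in> B n" if "a \<in> carr G" "src G a \<notin> N" for a
    using B(4) that unfolding over_def space_bspace by auto
  show thesis by (rule that[OF B(1-3) cover B(5)])
qed

section \<open>The fibrewise counting measure and its null sets\<close>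

lemma sets_counting [simp]: "sets (counting_measure G \<mu>) = sets (bspace G)"
  unfolding counting_measure_def space_bspace[symmetric]
  by (simp add: sets_measure_of sets.space_closed sets.sigma_sets_eq)

lemma space_counting [simp]: "space (counting_measure G \<mu>) = carr G"
  using sets_eq_imp_space_eq[OF sets_counting] by (simp add: space_bspace)

abbreviation counting_integral :: "'g set \<Rightarrow> ennreal" where
  "counting_integral A \<equiv> \<integral>\<^sup>+ x. (\<integral>\<^sup>+ a. indicator A a \<partial>count_space (sfibre G x)) \<partial>\<mu>"

text \<open>\<open>measure_of\<close> returns the zero measure when the given set function is not a
  measure. Both cases are carried along: bounds from above and null sets can be treated in
  either.\<close>

lemma emeasure_counting:
  "(\<forall>A\<in>sets (bspace G). emeasure (counting_measure G \<mu>) A = counting_integral A) \<or>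
   (\<forall>A. emeasure (counting_measure G \<mu>) A = 0)"
  unfolding counting_measure_def space_bspace[symmetric]
  by (simp add: emeasure_measure_of_conv sets.sigma_sets_eq)

lemma emeasure_counting_le: "emeasure (counting_measure G \<mu>) A \<le> counting_integral A"
proof (cases "A \<in> sets (bspace G)")
  case True
  with emeasure_counting show ?thesis by auto
next
  case False
  thus ?thesis by (simp add: emeasure_notin_sets)
qed

text \<open>For the source map this is immediate from the integral formula. Inversion exchanges
  source and range, and quasi-invariance carries the null set over.\<close>

lemma null_over:
  assumes N: "N \<in> null_sets \<mu>"
  shows "{a \<in> carr G. rng G a \<in> N} \<in> null_sets (counting_measure G \<mu>)"
proof -
  let ?\<nu> = "counting_measure G \<mu>"
  define Z where "Z = {a \<in> carr G. rng G a \<in> N}"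
  define Y where "Y = {a \<in> carr G. src G a \<in> N}"
  have N_sets: "N \<in> sets \<mu>" using N by auto
  have Z: "Z \<in> sets (bspace G)"
    using measurable_sets[OF rng_measurable N_sets] unfolding Z_def space_bspace vimage_def
    by (simp add: Int_def conj_commute)
  have "counting_integral Y = (\<integral>\<^sup>+ x. 0 \<partial>\<mu>)"
  proof (rule nn_integral_cong_AE)
    show "AE x in \<mu>. (\<integral>\<^sup>+ a. indicator Y a \<partial>count_space (sfibre G x)) = 0"
      using AE_not_in[OF N]
    proof eventually_elim
      case (elim x)
      have "(\<integral>\<^sup>+ a. indicator Y a \<partial>count_space (sfibre G x)) = (\<integral>\<^sup>+ a. 0 \<partial>count_space (sfibre G x))"
        using elim by (intro nn_integral_cong) (auto simp: Y_def sfibre_def)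
      thus ?case by simp
    qed
  qed
  hence "emeasure ?\<nu> Y = 0" using emeasure_counting_le[of Y] by simp
  moreover have "ginv G -` Z \<inter> carr G = Y" unfolding Y_def Z_def using inv_in rng_inv by auto
  moreover have inv: "ginv G \<in> measurable ?\<nu> (bspace G)"
    using inv_borel measurable_cong_sets[OF sets_counting refl] by blast
  ultimately have "emeasure (distr ?\<nu> (bspace G) (ginv G)) Z = 0"
    using emeasure_distr[OF inv Z] by simp
  hence "Z \<in> null_sets (distr ?\<nu> (bspace G) (ginv G))" using Z by (intro null_setsI) auto
  thus ?thesis
    using quasi_inv unfolding quasi_invariant_def Let_def absolutely_continuous_def Z_def by auto
qed

text \<open>The saturation of a null set need not be known to be measurable here, but it has inner
  measure zero. This suffices, as \<open>\<nu>\<close> is given by a lower integral.\<close>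

lemma null_saturation:
  assumes Z: "Z \<in> null_sets (counting_measure G \<mu>)" and W: "W \<in> sets (bspace G)"
    and sat: "\<And>a. a \<in> W \<Longrightarrow> \<exists>d\<in>Z. src G d = src G a"
  shows "W \<in> null_sets (counting_measure G \<mu>)"
proof -
  let ?\<nu> = "counting_measure G \<mu>"
  have Z_sets: "Z \<in> sets (bspace G)" using Z by auto
  have "emeasure ?\<nu> W = 0"
    using emeasure_counting
  proof
    assume formula: "\<forall>A\<in>sets (bspace G). emeasure ?\<nu> A = counting_integral A"
    have Z0: "counting_integral Z = 0" using formula Z_sets Z by auto
    have "counting_integral W \<le> 0"
      unfolding nn_integral_def[of \<mu>]
    proof (rule SUP_least, clarsimp)
      fix g assume g: "simple_function \<mu> g"
        "g \<le> (\<lambda>x. \<integral>\<^sup>+ a. indicator W a \<partial>count_space (sfibre G x))"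
      note [measurable] = borel_measurable_simple_function[OF g(1)]
      \<comment> \<open>Every source fibre over \<open>P\<close> meets \<open>W\<close> and
        therefore \<open>Z\<close>, so the fibre count of \<open>Z\<close> dominates the indicator
        of \<open>P\<close>. Being the support of a simple function, \<open>P\<close> is
        measurable.\<close>
      define P where "P = {x \<in> space \<mu>. g x \<noteq> 0}"
      have P [measurable]: "P \<in> sets \<mu>" unfolding P_def by measurable
      have "emeasure \<mu> P = (\<integral>\<^sup>+ x. indicator P x \<partial>\<mu>)" using P by simp
      also have "\<dots> \<le> counting_integral Z"
      proof (rule nn_integral_mono)
        fix x assume "x \<in> space \<mu>"
        show "indicator P x \<le> (\<integral>\<^sup>+ a. indicator Z a \<partial>count_space (sfibre G x))"
        proof (cases "x \<in> P")
          case True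
          have "\<exists>a\<in>sfibre G x. a \<in> W"
          proof (rule ccontr)
            assume "\<not> (\<exists>a\<in>sfibre G x. a \<in> W)"
            hence "(\<integral>\<^sup>+ a. indicator W a \<partial>count_space (sfibre G x)) = (\<integral>\<^sup>+ a. 0 \<partial>count_space (sfibre G x))"
              by (intro nn_integral_cong) auto
            moreover have "g x \<le> (\<integral>\<^sup>+ a. indicator W a \<partial>count_space (sfibre G x))"
              using g(2) by (simp add: le_fun_def)
            ultimately have "g x = 0" by simp
            with True show False unfolding P_def by simp
          qed
          then obtain a where a: "a \<in> sfibre G x" "a \<in> W" by auto
          then obtain d where d: "d \<in> Z" "src G d = x" using sat[of a] unfolding sfibre_def by auto
          hence dx: "d \<in> sfibre G x"
            using sets.sets_into_space[OF Z_sets] unfolding sfibre_def space_bspace by auto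
          have "(1::ennreal) = emeasure (count_space (sfibre G x)) {d}"
            using dx by (simp add: emeasure_count_space)
          also have "\<dots> = (\<integral>\<^sup>+ a. indicator {d} a \<partial>count_space (sfibre G x))"
            using dx by (intro nn_integral_indicator[symmetric]) simp
          also have "\<dots> \<le> (\<integral>\<^sup>+ a. indicator Z a \<partial>count_space (sfibre G x))"
            using d(1) by (intro nn_integral_mono) (auto split: split_indicator)
          finally show ?thesis using True by simp
        qed simp
      qed
      finally have "emeasure \<mu> P = 0" using Z0 by simp
      hence "AE x in \<mu>. g x = 0" by (intro AE_I[of _ _ P]) (auto simp: P_def)
      hence "(\<integral>\<^sup>+ x. g x \<partial>\<mu>) = 0" using nn_integral_0_iff_AE[of g \<mu>] by simp
      thus "integral\<^sup>S \<mu> g = 0" using nn_integral_eq_simple_integral[OF g(1)] by simp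
    qed
    with formula W show ?thesis by simp
  qed simp
  with W show ?thesis by (intro null_setsI) auto
qed

section \<open>Word length for sets with bounded source fibres\<close>

lemma finite_fibres_measure:
  assumes "\<And>x. x \<in> units G \<Longrightarrow> finite (A \<inter> sfibre G x) \<and> card (A \<inter> sfibre G x) \<le> C"
  shows "emeasure (counting_measure G \<mu>) A < \<infinity>"
proof -
  have "emeasure (counting_measure G \<mu>) A \<le> counting_integral A" by (rule emeasure_counting_le)
  also have "\<dots> \<le> (\<integral>\<^sup>+ x. of_nat C \<partial>\<mu>)"
  proof (rule nn_integral_mono)
    fix x assume "x \<in> space \<mu>"
    hence fin: "finite (A \<inter> sfibre G x)" "card (A \<inter> sfibre G x) \<le> C" using assms by (auto simp: space_mu)
    have "(\<integral>\<^sup>+ a. indicator A a \<partial>count_space (sfibre G x)) =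
        (\<integral>\<^sup>+ a. indicator (A \<inter> sfibre G x) a \<partial>count_space (sfibre G x))"
      by (intro nn_integral_cong) (auto split: split_indicator)
    also have "\<dots> = emeasure (count_space (sfibre G x)) (A \<inter> sfibre G x)"
      by (intro nn_integral_indicator) auto
    also have "\<dots> = of_nat (card (A \<inter> sfibre G x))" using fin by (simp add: emeasure_count_space)
    also have "\<dots> \<le> of_nat C" using fin(2) by simp
    finally show "(\<integral>\<^sup>+ a. indicator A a \<partial>count_space (sfibre G x)) \<le> of_nat C" .
  qed
  also have "\<dots> = of_nat C" by (simp add: emeasure_space_1)
  also have "\<dots> < \<infinity>" by (simp add: of_nat_less_top)
  finally show ?thesis .
qed

text \<open>The last factor of a product has at most \<open>n\<close> choices in the given source
  fibre, and its range fixes the source fibre of the remaining product.\<close>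

lemma set_power_fibres:
  assumes Q: "Q \<subseteq> carr G" "\<And>x. x \<in> units G \<Longrightarrow> finite (Q \<inter> sfibre G x) \<and> card (Q \<inter> sfibre G x) \<le> n"
  shows "x \<in> units G \<Longrightarrow> finite (set_power G Q k \<inter> sfibre G x) \<and> card (set_power G Q k \<inter> sfibre G x) \<le> n ^ k"
proof (induction k arbitrary: x)
  case 0
  have sub: "set_power G Q 0 \<inter> sfibre G x \<subseteq> {x}" unfolding sfibre_def by (auto simp: src_unit)
  show ?case using finite_subset[OF sub] card_mono[OF _ sub] by simp
next
  case (Suc k)
  let ?P = "set_power G Q k"
  let ?R = "\<lambda>q. (\<lambda>p. gmult G p q) ` (?P \<inter> sfibre G (rng G q))"
  have sub: "set_power G Q (Suc k) \<inter> sfibre G x \<subseteq> (\<Union>q\<in>Q \<inter> sfibre G x. ?R q)"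
  proof
    fix a assume a: "a \<in> set_power G Q (Suc k) \<inter> sfibre G x"
    then obtain p q where pq: "a = gmult G p q" "p \<in> ?P" "q \<in> Q" "(p, q) \<in> composable G"
      by (auto simp: set_mult_def)
    hence "src G q = x" using a src_mult[OF pq(4)] unfolding sfibre_def by simp
    with pq have "q \<in> Q \<inter> sfibre G x" "p \<in> ?P \<inter> sfibre G (rng G q)"
      unfolding sfibre_def by (simp_all add: composable_iff)
    with pq(1) show "a \<in> (\<Union>q\<in>Q \<inter> sfibre G x. ?R q)" by auto
  qed
  have R: "finite (?R q)" "card (?R q) \<le> n ^ k" if "q \<in> Q \<inter> sfibre G x" for q
  proof -
    have "rng G q \<in> units G" using that Q(1) rng_in by auto
    from Suc.IH[OF this] show "finite (?R q)" "card (?R q) \<le> n ^ k"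
      using card_image_le[of "?P \<inter> sfibre G (rng G q)" "\<lambda>p. gmult G p q"] by auto
  qed
  have fin: "finite (Q \<inter> sfibre G x)" "card (Q \<inter> sfibre G x) \<le> n" using Q(2)[OF Suc.prems] by auto
  have finU: "finite (\<Union>q\<in>Q \<inter> sfibre G x. ?R q)" using fin(1) R(1) by auto
  have "card (set_power G Q (Suc k) \<inter> sfibre G x) \<le> card (\<Union>q\<in>Q \<inter> sfibre G x. ?R q)"
    by (rule card_mono[OF finU sub])
  also have "\<dots> \<le> (\<Sum>q\<in>Q \<inter> sfibre G x. card (?R q))" by (rule card_UN_le[OF fin(1)])
  also have "\<dots> \<le> (\<Sum>q\<in>Q \<inter> sfibre G x. n ^ k)" by (intro sum_mono R(2))
  also have "\<dots> \<le> n ^ Suc k" using fin(2) by simp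
  finally show ?case using finite_subset[OF sub finU] by simp
qed

text \<open>If the second factor \<open>q\<close> lies in \<open>B i\<close>, it is recovered from
  the source of the product \<open>a\<close> as \<open>\<beta> i (src G a)\<close>, and the first
  factor is \<open>a\<close> times the inverse of \<open>q\<close>. The product set is thus a finite
  union of preimages under Borel maps.\<close>

lemma set_mult_borel:
  fixes B :: "nat \<Rightarrow> 'g set"
  assumes B: "\<And>n. B n \<in> sets (bspace G)" "\<And>n. inj_on (src G) (B n)"
    and B_image: "\<And>n A. A \<in> sets (bspace G) \<Longrightarrow> src G ` (B n \<inter> A) - N \<in> sets \<mu>"
    and P: "P \<in> sets (bspace G)" and Q: "Q \<in> sets (bspace G)"
    and Q_cover: "\<And>q. q \<in> Q \<Longrightarrow> src G q \<notin> N \<and> (\<exists>i<n. q \<in> B i)"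
  shows "set_mult G P Q \<in> sets (bspace G)"
proof -
  let ?M = "bspace G"
  have P_carr: "P \<subseteq> carr G" and Q_carr: "Q \<subseteq> carr G" and B_carr: "B i \<subseteq> carr G" for i
    using sets.sets_into_space P Q B(1) unfolding space_bspace[symmetric] by auto
  define D where "D i = src G ` B i - N" for i
  define \<beta> where "\<beta> i = inv_into (B i) (src G)" for i
  define W where "W i = {a \<in> carr G. src G a \<in> D i}" for i
  define T where "T i = {a \<in> W i. \<beta> i (src G a) \<in> Q \<and> gmult G a (ginv G (\<beta> i (src G a))) \<in> P}" for i
  have \<beta>: "\<beta> i (src G q) = q" if "q \<in> B i" for i q
    unfolding \<beta>_def using B(2) that by (rule inv_into_f_f)
  have \<beta>': "\<beta> i x \<in> B i" "src G (\<beta> i x) = x" if "x \<in> D i" for i x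
    using that unfolding \<beta>_def D_def by (auto intro: inv_into_into f_inv_into_f)
  have D: "D i \<in> sets \<mu>" for i
    using B_image[OF sets.top, of i] B_carr[of i] unfolding D_def space_bspace by (simp add: Int_absorb2)
  have \<beta>_meas: "\<beta> i \<in> measurable (restrict_space \<mu> (D i)) ?M" for i
  proof (rule measurableI)
    fix x assume "x \<in> space (restrict_space \<mu> (D i))"
    thus "\<beta> i x \<in> space ?M" using \<beta>'(1)[of x i] B_carr[of i] by (auto simp: space_restrict_space space_bspace)
  next
    fix A assume A: "A \<in> sets ?M"
    \<comment> \<open>Preimages under the inverse of a section are images under the source map; here
      the Borel images off \<open>N\<close> are needed.\<close>
    have "\<beta> i -` A \<inter> D i = src G ` (B i \<inter> A) - N"
    proof (intro equalityI subsetI)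
      fix x assume x: "x \<in> \<beta> i -` A \<inter> D i"
      hence "x = src G (\<beta> i x)" "\<beta> i x \<in> B i \<inter> A" using \<beta>'[of x i] by auto
      thus "x \<in> src G ` (B i \<inter> A) - N" using x unfolding D_def by auto
    next
      fix x assume "x \<in> src G ` (B i \<inter> A) - N"
      thus "x \<in> \<beta> i -` A \<inter> D i" using \<beta>[of _ i] unfolding D_def by auto
    qed
    moreover have "space (restrict_space \<mu> (D i)) = D i" using D by simp
    ultimately show "\<beta> i -` A \<inter> space (restrict_space \<mu> (D i)) \<in> sets (restrict_space \<mu> (D i))"
      using B_image[OF A, of i] D[of i] by (subst sets_restrict_space_iff) (auto simp: D_def)
  qed
  have W: "W i \<in> sets ?M" for i
    using measurable_sets[OF src_measurable D[of i]] unfolding W_def space_bspace vimage_def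
    by (simp add: Int_def conj_commute)
  have T: "T i \<in> sets ?M" for i
  proof -
    let ?R = "restrict_space ?M (W i)"
    have space_R: "space ?R = W i" using W by simp
    have "src G \<in> measurable ?R (restrict_space \<mu> (D i))"
    proof (intro measurable_restrict_space2 measurable_restrict_space1[OF src_measurable] Pi_I)
      fix a assume "a \<in> space ?R"
      thus "src G a \<in> D i" unfolding space_R by (simp add: W_def)
    qed
    from measurable_compose[OF this \<beta>_meas]
    have f: "(\<lambda>a. \<beta> i (src G a)) \<in> measurable ?R ?M" .
    have "(\<lambda>a. (a, ginv G (\<beta> i (src G a)))) \<in> measurable ?R (?M \<Otimes>\<^sub>M ?M)"
      using measurable_restrict_space1[OF measurable_ident] measurable_compose[OF f inv_borel]
      by (intro measurable_Pair) (auto simp: id_def)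
    hence "(\<lambda>a. (a, ginv G (\<beta> i (src G a)))) \<in> measurable ?R (restrict_space (?M \<Otimes>\<^sub>M ?M) (composable G))"
    proof (intro measurable_restrict_space2 Pi_I)
      fix a assume "a \<in> space ?R"
      hence a: "a \<in> carr G" "src G a \<in> D i" unfolding space_R by (simp_all add: W_def)
      have "\<beta> i (src G a) \<in> carr G" "src G (\<beta> i (src G a)) = src G a" using \<beta>'[OF a(2)] B_carr[of i] by auto
      with a(1) show "(a, ginv G (\<beta> i (src G a))) \<in> composable G" by (intro div_props(1)) auto
    qed
    from measurable_compose[OF this mult_borel]
    have g: "(\<lambda>a. gmult G a (ginv G (\<beta> i (src G a)))) \<in> measurable ?R ?M" by simp
    have "T i = ((\<lambda>a. \<beta> i (src G a)) -` Q \<inter> space ?R) \<inter> ((\<lambda>a. gmult G a (ginv G (\<beta> i (src G a)))) -` P \<inter> space ?R)"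
      unfolding space_R by (auto simp: T_def)
    hence "T i \<in> sets ?R" using measurable_sets[OF f Q] measurable_sets[OF g P] by auto
    thus ?thesis using W[of i] sets_restrict_space_iff[of "W i" ?M] by auto
  qed
  have "set_mult G P Q = (\<Union>i<n. T i)"
  proof (intro equalityI subsetI)
    fix a assume "a \<in> set_mult G P Q"
    then obtain p q where pq: "a = gmult G p q" "p \<in> P" "q \<in> Q" "(p, q) \<in> composable G"
      by (auto simp: set_mult_def)
    obtain i where i: "i < n" "q \<in> B i" "src G q \<notin> N" using Q_cover[OF pq(3)] by auto
    have a: "a \<in> carr G" "src G a = src G q" using mult_in[OF pq(4)] src_mult[OF pq(4)] pq(1) by auto
    have "a \<in> T i"
      unfolding T_def W_def D_def using a i \<beta>[OF i(2)] pq mult_inv_right[OF pq(4)] by auto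
    with i(1) show "a \<in> (\<Union>i<n. T i)" by auto
  next
    fix a assume "a \<in> (\<Union>i<n. T i)"
    then obtain i where i: "a \<in> T i" by auto
    define q where "q = \<beta> i (src G a)"
    define p where "p = gmult G a (ginv G q)"
    have a: "a \<in> carr G" "src G a \<in> D i" "q \<in> Q" "p \<in> P"
      using i unfolding T_def W_def q_def p_def by auto
    have q: "q \<in> carr G" "src G a = src G q" using \<beta>'[OF a(2)] a(3) Q_carr unfolding q_def by auto
    have "(p, q) \<in> composable G" "gmult G p q = a"
      using div_props(2,3)[OF a(1) q] unfolding p_def by auto
    with a(3,4) show "a \<in> set_mult G P Q" by (auto simp: set_mult_def)
  qed
  moreover have "(\<Union>i<n. T i) \<in> sets ?M" by (rule sets.finite_UN[OF finite_lessThan T])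
  ultimately show ?thesis by (simp only:)
qed

lemma length_exp_borel:
  assumes "\<And>k. set_power G Q k \<in> sets (bspace G)"
  shows "(\<lambda>a. complex_of_real (length_exp Q t a)) \<in> borel_measurable (bspace G)"
proof -
  note [measurable] = assms
  have "(\<lambda>a. LEAST k. a \<in> set_power G Q k) \<in> measurable (bspace G) (count_space UNIV)"
    by (rule measurable_Least) measurable
  from measurable_compose[OF this, of "\<lambda>k. t ^ k" borel]
  have [measurable]: "(\<lambda>a. t ^ (LEAST k. a \<in> set_power G Q k)) \<in> borel_measurable (bspace G)" by simp
  show ?thesis unfolding length_exp_def by measurable
qed

text \<open>The exceptional null set is \<open>units G - U\<close>; over \<open>U\<close> the
  matrices are those of the kernel of a forest.\<close>

lemma length_exp_positive_definite:
  assumes U: "U \<subseteq> units G" "units G - U \<in> null_sets \<mu>" and Q: "treeing (reduction G U) Q"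
    and Q': "Q' \<subseteq> Q" "ginv G ` Q' \<subseteq> Q'" and borel: "\<And>k. set_power G Q' k \<in> sets (bspace G)"
    and t: "0 \<le> t" "t \<le> 1"
  shows "positive_definite G \<mu> (\<lambda>a. complex_of_real (length_exp Q' t a))"
  unfolding positive_definite_def
proof (intro conjI length_exp_borel borel bexI[OF _ U(2)] ballI allI impI)
  fix x k and g :: "nat \<Rightarrow> 'g" assume x: "x \<in> units G - (units G - U)" and g: "\<forall>i<k. g i \<in> rfibre G x"
  have xU: "x \<in> U" using x U(1) by auto
  have Q'_carr: "Q' \<subseteq> carr G" using Q'(1) treeing_reduction(2)[OF U(1) Q] by auto
  interpret forest "cayley Q' x" by (rule cayley_forest[OF U(1) Q Q' xU])
  show "psd_matrix k (\<lambda>i j. complex_of_real (length_exp Q' t (gmult G (ginv G (g i)) (g j))))"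
    unfolding psd_matrix_def
  proof
    fix c :: "nat \<Rightarrow> complex"
    have "(\<Sum>i<k. \<Sum>j<k. cnj (c i) * complex_of_real (length_exp Q' t (gmult G (ginv G (g i)) (g j))) * c j) =
        (\<Sum>i<k. \<Sum>j<k. cnj (c i) * complex_of_real (dist_kernel (cayley Q' x) t (g i) (g j)) * c j)"
      using g by (intro sum.cong refl) (simp add: length_exp_kernel[OF Q'_carr])
    also have "\<dots> \<in> \<real>\<^sub>\<ge>\<^sub>0" by (rule dist_kernel_pos[OF t]) simp
    finally show "(\<Sum>i<k. \<Sum>j<k. cnj (c i) *
        complex_of_real (length_exp Q' t (gmult G (ginv G (g i)) (g j))) * c j) \<in> \<real>\<^sub>\<ge>\<^sub>0" .
  qed
qed

text \<open>As \<open>t < 1\<close>, a value above \<open>\<epsilon>\<close> forces a word length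
  below some \<open>K\<close>, and the words of each length are bounded in number on every source
  fibre.\<close>

lemma length_exp_level_finite:
  assumes Q: "Q \<subseteq> carr G" "\<And>x. x \<in> units G \<Longrightarrow> finite (Q \<inter> sfibre G x) \<and> card (Q \<inter> sfibre G x) \<le> n"
    and t: "0 \<le> t" "t < 1" and \<epsilon>: "\<epsilon> > 0"
  shows "emeasure (counting_measure G \<mu>) {a \<in> carr G. norm (complex_of_real (length_exp Q t a)) > \<epsilon>} < \<infinity>"
proof -
  obtain K where K: "t ^ K < \<epsilon>" using real_arch_pow_inv[OF \<epsilon> t(2)] by auto
  let ?A = "{a \<in> carr G. norm (complex_of_real (length_exp Q t a)) > \<epsilon>}"
  have sub: "?A \<subseteq> (\<Union>k<K. set_power G Q k)"
  proof
    fix a assume "a \<in> ?A"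
    hence a: "length_exp Q t a > \<epsilon>" using t by (auto simp: length_exp_def split: if_splits)
    hence ex: "\<exists>k. a \<in> set_power G Q k" using \<epsilon> by (auto simp: length_exp_def split: if_splits)
    define k where "k = (LEAST k. a \<in> set_power G Q k)"
    have "a \<in> set_power G Q k" unfolding k_def using ex by (rule LeastI_ex)
    moreover have "t ^ k > \<epsilon>" using a ex unfolding length_exp_def k_def by simp
    hence "k < K" using K power_decreasing[of K k t] t by (cases "K \<le> k") auto
    ultimately show "a \<in> (\<Union>k<K. set_power G Q k)" by auto
  qed
  show ?thesis
  proof (rule finite_fibres_measure)
    fix x assume x: "x \<in> units G"
    let ?P = "\<lambda>k. set_power G Q k \<inter> sfibre G x"
    have P: "finite (?P k)" "card (?P k) \<le> n ^ k" for k using set_power_fibres[OF Q x] by auto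
    have sub': "?A \<inter> sfibre G x \<subseteq> (\<Union>k<K. ?P k)" using sub by auto
    have fin: "finite (\<Union>k<K. ?P k)" by (rule finite_UN_I[OF finite_lessThan P(1)])
    have "card (?A \<inter> sfibre G x) \<le> card (\<Union>k<K. ?P k)" by (rule card_mono[OF fin sub'])
    also have "\<dots> \<le> (\<Sum>k<K. card (?P k))" by (rule card_UN_le) simp
    also have "\<dots> \<le> (\<Sum>k<K. n ^ k)" by (intro sum_mono P(2))
    finally show "finite (?A \<inter> sfibre G x) \<and> card (?A \<inter> sfibre G x) \<le> (\<Sum>k<K. n ^ k)"
      using finite_subset[OF sub' fin] by simp
  qed
qed

text \<open>Enlarging \<open>Q\<close> does not increase the word length of \<open>a\<close>, so the
  values are eventually at least the \<open>k\<close>-th power of the base, with \<open>k\<close>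
  fixed.\<close>

lemma length_exp_tendsto:
  assumes mono: "\<And>n. Q n \<subseteq> Q (Suc n)" and a: "a \<in> set_power G (Q n0) k"
  shows "(\<lambda>n. complex_of_real (length_exp (Q n) (1 - 1 / real (n + 2)) a)) \<longlonglongrightarrow> 1"
proof -
  define t where "t n = 1 - 1 / real (n + 2)" for n
  have t: "0 \<le> t n" "t n \<le> 1" for n unfolding t_def by (simp_all add: field_simps)
  have "(\<lambda>n. 1 / real (n + 2)) \<longlonglongrightarrow> 0"
    using LIMSEQ_ignore_initial_segment[OF lim_1_over_n, of 2] by simp
  hence "t \<longlonglongrightarrow> 1 - 0" unfolding t_def by (intro tendsto_diff tendsto_const)
  hence lim: "(\<lambda>n. t n ^ k) \<longlonglongrightarrow> 1" using tendsto_power[of t 1 sequentially k] by simp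
  have bounds: "t n ^ k \<le> length_exp (Q n) (t n) a \<and> length_exp (Q n) (t n) a \<le> 1" if n: "n \<ge> n0" for n
  proof -
    have "Q n0 \<subseteq> Q n" using n by (rule lift_Suc_mono_le[of Q, OF mono])
    from set_power_mono[OF this] have an: "a \<in> set_power G (Q n) k" using a by auto
    hence "(LEAST j. a \<in> set_power G (Q n) j) \<le> k" by (rule Least_le)
    with an t[of n] show ?thesis
      unfolding length_exp_def by (auto intro: power_decreasing power_le_one)
  qed
  have "(\<lambda>n. length_exp (Q n) (t n) a) \<longlonglongrightarrow> 1"
  proof (rule tendsto_sandwich[OF _ _ lim tendsto_const])
    show "\<forall>\<^sub>F n in sequentially. t n ^ k \<le> length_exp (Q n) (t n) a"
      using bounds by (auto simp: eventually_sequentially)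
    show "\<forall>\<^sub>F n in sequentially. length_exp (Q n) (t n) a \<le> 1"
      using bounds by (auto simp: eventually_sequentially)
  qed
  from tendsto_of_real[OF this] show ?thesis unfolding t_def by simp
qed

section \<open>Exhaustion of the treeing by sets of bounded degree\<close>

theorem haagerup_if_treeable:
  assumes "treeable G \<mu>"
  shows "haagerup_property G \<mu>"
proof -
  let ?M = "bspace G" and ?\<nu> = "counting_measure G \<mu>"
  obtain U Q where U': "U \<in> sets (unit_borel G)" and U_null: "units G - U \<in> null_sets \<mu>"
    and Q: "treeing (reduction G U) Q"
    using assms unfolding treeable_def treeable_borel_def by auto
  have U: "U \<subseteq> units G" and U_sets: "U \<in> sets \<mu>" using U' sets_mu sets_mu_iff by auto
  note tr = treeing_reduction[OF U Q]
  have Q_sets: "Q \<in> sets ?M"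
  proof -
    have "{a \<in> carr G. rng G a \<in> U \<and> src G a \<in> U} = (rng G -` U \<inter> space ?M) \<inter> (src G -` U \<inter> space ?M)"
      by (auto simp: space_bspace)
    hence "{a \<in> carr G. rng G a \<in> U \<and> src G a \<in> U} \<in> sets ?M"
      using measurable_sets[OF rng_measurable U_sets] measurable_sets[OF src_measurable U_sets] by auto
    moreover have "Q \<in> sets (restrict_space ?M {a \<in> carr G. rng G a \<in> U \<and> src G a \<in> U})"
      using Q unfolding treeing_def graphing_def reduction_def by simp
    ultimately show ?thesis
      using sets_restrict_space_iff[of "{a \<in> carr G. rng G a \<in> U \<and> src G a \<in> U}" ?M] by auto
  qed
  obtain B :: "nat \<Rightarrow> 'g set" and N where B: "\<And>n. B n \<in> sets ?M" "\<And>n. inj_on (src G) (B n)"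
    and N: "N \<in> null_sets \<mu>" and B_cover: "\<And>a. a \<in> carr G \<Longrightarrow> src G a \<notin> N \<Longrightarrow> \<exists>n. a \<in> B n"
    and B_image: "\<And>n A. A \<in> sets ?M \<Longrightarrow> src G ` (B n \<inter> A) - N \<in> sets \<mu>"
    by (rule source_sections) (rule that)
  define E where "E n = (\<Union>i<n. B i)" for n :: nat
  \<comment> \<open>The conditions form pairs exchanged by inversion, which makes \<open>R n\<close>
    symmetric. Membership in \<open>E n\<close>, a union of \<open>n\<close> sections, bounds the
    source fibres.\<close>
  define R where "R n = {q \<in> Q. src G q \<notin> N \<and> rng G q \<notin> N \<and> q \<in> E n \<and> ginv G q \<in> E n}" for n
  have R_Q: "R n \<subseteq> Q" for n unfolding R_def by auto
  have R_inv: "ginv G ` R n \<subseteq> R n" for n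
  proof
    fix a assume "a \<in> ginv G ` R n"
    then obtain q where q: "q \<in> R n" "a = ginv G q" by auto
    moreover have "q \<in> carr G" using q(1) R_Q tr(2) by auto
    moreover have "ginv G q \<in> Q" using q(1) R_Q tr(1) by auto
    ultimately show "a \<in> R n" unfolding R_def by (simp add: src_inv rng_inv inv_inv)
  qed
  have R_sets: "R n \<in> sets ?M" for n
  proof -
    have E: "E n \<in> sets ?M" unfolding E_def using B(1) by auto
    have "R n = Q \<inter> E n \<inter> (ginv G -` E n \<inter> space ?M) - (src G -` N \<inter> space ?M) - (rng G -` N \<inter> space ?M)"
      using tr(2) unfolding R_def space_bspace by auto
    thus ?thesis
      using Q_sets E measurable_sets[OF inv_borel E] N measurable_sets[OF src_measurable, of N]
        measurable_sets[OF rng_measurable, of N] by auto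
  qed
  have R_mono: "R n \<subseteq> R (Suc n)" for n unfolding R_def E_def by (auto simp: less_Suc_eq)
  have R_fibre: "finite (R n \<inter> sfibre G x) \<and> card (R n \<inter> sfibre G x) \<le> n" for n x
  proof -
    have sub: "R n \<inter> sfibre G x \<subseteq> (\<lambda>i. inv_into (B i) (src G) x) ` {..<n}"
    proof
      fix q assume "q \<in> R n \<inter> sfibre G x"
      then obtain i where i: "i < n" "q \<in> B i" "src G q = x" unfolding R_def E_def sfibre_def by auto
      hence "q = inv_into (B i) (src G) x" using inv_into_f_f[OF B(2) i(2)] by simp
      with i(1) show "q \<in> (\<lambda>i. inv_into (B i) (src G) x) ` {..<n}" by auto
    qed
    have "card (R n \<inter> sfibre G x) \<le> card ((\<lambda>i. inv_into (B i) (src G) x) ` {..<n})"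
      using sub by (intro card_mono) auto
    also have "\<dots> \<le> n" using card_image_le[of "{..<n}"] by simp
    finally show ?thesis using finite_subset[OF sub] by simp
  qed
  have power_sets: "set_power G (R n) k \<in> sets ?M" for n k
  proof (induction k)
    case 0
    show ?case using units_borel by simp
  next
    case (Suc k)
    have "set_mult G (set_power G (R n) k) (R n) \<in> sets ?M"
      by (rule set_mult_borel[OF B B_image Suc R_sets]) (auto simp: R_def E_def)
    thus ?case by simp
  qed
  \<comment> \<open>Below 1 for each \<open>n\<close>, as finite level sets require, and tending to
    1 for the pointwise limit.\<close>
  define t :: "nat \<Rightarrow> real" where "t n = 1 - 1 / real (n + 2)" for n
  have t: "0 \<le> t n" "t n < 1" for n unfolding t_def by (simp_all add: field_simps)
  define F where "F n a = complex_of_real (length_exp (R n) (t n) a)" for n a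
  define Z where "Z = {a \<in> carr G. rng G a \<in> N \<union> (units G - U)}"
  have Z: "Z \<in> null_sets ?\<nu>" unfolding Z_def using N U_null by (intro null_over null_sets.Un)
  define W where "W = carr G - (\<Union>n. \<Union>k. set_power G (R n) k)"
  have W_sets: "W \<in> sets ?M" unfolding W_def space_bspace[symmetric] using power_sets by auto
  \<comment> \<open>The ranges of the elements \<open>d\<close> with the source of \<open>p\<close>
    form the orbit of that source, which contains all units met along a factorization of
    \<open>p\<close>. If the orbit avoids \<open>N\<close>, each of the finitely many factors lies
    in some \<open>R n\<close>, and one \<open>n\<close> serves them all.\<close>
  have reach: "\<exists>n. p \<in> set_power G (R n) k"
    if "p \<in> set_power G Q k" "\<And>d. d \<in> carr G \<Longrightarrow> src G d = src G p \<Longrightarrow> rng G d \<notin> N \<union> (units G - U)" for p k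
    using that
  proof (induction k arbitrary: p)
    case (Suc k)
    then obtain p' q where pq: "p = gmult G p' q" "p' \<in> set_power G Q k" "q \<in> Q" "(p', q) \<in> composable G"
      by (auto simp: set_mult_def)
    have carr: "p' \<in> carr G" "q \<in> carr G" "src G p' = rng G q" using pq(4) by (simp_all add: composable_iff)
    have src_p: "src G p = src G q" using src_mult[OF pq(4)] pq(1) by simp
    have "rng G d \<notin> N \<union> (units G - U)" if d: "d \<in> carr G" "src G d = src G p'" for d
    proof -
      have c: "(d, q) \<in> composable G" using d carr by (simp add: composable_iff)
      show ?thesis using Suc.prems(2)[OF mult_in[OF c]] src_mult[OF c] rng_mult[OF c] src_p by simp
    qed
    then obtain m where m: "p' \<in> set_power G (R m) k" using Suc.IH[OF pq(2)] by auto
    have rq: "rng G q \<notin> N" using Suc.prems(2)[OF carr(2)] src_p by auto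
    have u: "src G q \<in> units G" using src_in carr(2) by auto
    \<comment> \<open>The unit \<open>src G q\<close> is itself an element with the source of
      \<open>p\<close>, so the assumption on ranges applies to it.\<close>
    have sq: "src G q \<notin> N" using Suc.prems(2)[of "src G q"] unit_carr[OF u] src_unit[OF u] rng_unit[OF u] src_p by auto
    obtain i where i: "q \<in> B i" using B_cover[OF carr(2) sq] by auto
    obtain j where j: "ginv G q \<in> B j"
      using B_cover[OF inv_in[OF carr(2)]] rq src_inv[OF carr(2)] by auto
    define n where "n = max m (Suc (max i j))"
    have "i < n" "j < n" unfolding n_def by auto
    hence "q \<in> R n" unfolding R_def E_def using pq(3) rq sq i j by auto
    moreover have "R m \<subseteq> R n" unfolding n_def by (rule lift_Suc_mono_le[of R, OF R_mono]) simp
    from set_power_mono[OF this] have "p' \<in> set_power G (R n) k" using m by auto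
    ultimately have "p \<in> set_power G (R n) (Suc k)" using pq(1,4) by (auto simp: set_mult_def)
    thus ?case by auto
  qed simp
  have W: "W \<in> null_sets ?\<nu>"
  proof (rule null_saturation[OF Z W_sets])
    fix a assume a: "a \<in> W"
    have ac: "a \<in> carr G" using a unfolding W_def by auto
    show "\<exists>d\<in>Z. src G d = src G a"
    proof (rule ccontr)
      \<comment> \<open>The orbit of \<open>src G a\<close> then lies in \<open>U\<close> and avoids
        \<open>N\<close>: the first makes \<open>a\<close> a word in \<open>Q\<close>, the second a
        word in some \<open>R n\<close>.\<close>
      assume "\<not> (\<exists>d\<in>Z. src G d = src G a)"
      hence free: "\<And>d. d \<in> carr G \<Longrightarrow> src G d = src G a \<Longrightarrow> rng G d \<notin> N \<union> (units G - U)"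
        unfolding Z_def by auto
      have u: "src G a \<in> units G" using src_in ac by auto
      have "rng G a \<in> U" using free[OF ac] rng_in[OF ac] by auto
      moreover have "src G a \<in> U"
        using free[of "src G a"] unit_carr[OF u] src_unit[OF u] rng_unit[OF u] u by auto
      ultimately obtain k where "a \<in> set_power G Q k" using tr(3)[OF ac] by auto
      from reach[OF this free] a show False unfolding W_def by auto
    qed
  qed
  show ?thesis
    unfolding haagerup_property_def
  proof (intro exI[of _ F] conjI allI impI)
    fix n
    show "positive_definite G \<mu> (F n)"
      unfolding F_def using t[of n]
      by (intro length_exp_positive_definite[OF U U_null Q R_Q R_inv power_sets]) auto
    show "AE x in \<mu>. F n x = 1"
      using AE_space by eventually_elim (simp add: F_def space_mu length_exp_unit)
    fix \<epsilon> :: real assume "\<epsilon> > 0"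
    thus "emeasure ?\<nu> {a \<in> carr G. norm (F n a) > \<epsilon>} < \<infinity>"
      unfolding F_def using t[of n] R_Q[of n] tr(2) R_fibre[of n]
      by (intro length_exp_level_finite[of "R n" n]) auto
  next
    show "AE a in ?\<nu>. (\<lambda>n. F n a) \<longlonglongrightarrow> 1"
      using AE_not_in[OF W] AE_space
    proof eventually_elim
      case (elim a)
      then obtain n k where "a \<in> set_power G (R n) k" unfolding W_def by auto
      from length_exp_tendsto[of R, OF R_mono this] show ?case unfolding F_def t_def .
    qed
  qed
qed

end

theorem theorem8p4:
  fixes G :: "'g groupoid" and \<mu> :: "'g measure"
  assumes "countable_measured_groupoid G \<mu>"
    and "treeable G \<mu>"
  shows "haagerup_property G \<mu>"
  using countable_measured_groupoid.haagerup_if_treeable[OF assms] .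

end
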